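(* Let $\mathsf E=\{\mathsf E_x\}_{x\in\mathcal X}$ be a non-trivial observable on $\mathcal H_S$. (a) If $\mathsf E$ is completely unsharp, then there exists an $\mathsf E$-instrument $\mathcal I$, implemented by a measurement scheme constrained by the third law, such that $\mathcal I$ does not disturb any observable $\mathsf F$ commuting with $\mathsf E$. In fact $\mathcal F(\mathcal I_{\mathcal X}^* )=\mathsf E'$. (b) If $\|\mathsf E_x\|=1$ for some $x\in\mathcal X$, then there exists an orthogonal projection $P$ on $\mathcal H_S$ with the following two properties. First, $P$ commutes with every $\mathsf E_y$. Second, for every $\mathsf E$-instrument $\mathcal I$ implemented by a measurement scheme constrained by the third law, $\mathcal I_{\mathcal X}^*(P)\neq P$. In particular, the binary observable $\{P,\mathbb 1-P\}$ commutes with $\mathsf E$ but is disturbed by every such instrument.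
   Context: All Hilbert spaces are finite-dimensional and complex, and $\mathcal L(\mathcal H)$ denotes the linear operators on $\mathcal H$. A state is a positive operator of unit trace; it is full-rank if it is positive definite. A channel $\Phi:\mathcal L(\mathcal H)\to\mathcal L(\mathcal K)$ is a completely positive trace-preserving linear map. Its dual $\Phi^*:\mathcal L(\mathcal K)\to\mathcal L(\mathcal H)$ is defined by $\mathrm{tr}[A\Phi(B)]=\mathrm{tr}[\Phi^*(A)B]$. A channel is constrained by the third law if it maps every full-rank state on its input space to a full-rank state on its output space. Let $\mathcal H_S$ satisfy $2\le\dim\mathcal H_S<\infty$. An observable is a finite family $\mathsf E=\{\mathsf E_x\}_{x\in\mathcal X}$ of nonzero operators with $0\le\mathsf E_x\le\mathbb 1$ and $\sum_x\mathsf E_x=\mathbb 1$. It is non-trivial if some $\mathsf E_x$ is not a multiple of $\mathbb 1$. It is completely unsharp if, for every $x$, the spectrum of $\mathsf E_x$ contains neither $0$ nor $1$. An $\mathsf E$-instrument is a family $\mathcal I=\{\mathcal I_x\}_{x\in\mathcal X}$ of completely positive maps on $\mathcal L(\mathcal H_S)$ such that $\mathrm{tr}[\mathcal I_x(\rho)]=\mathrm{tr}[\mathsf E_x\rho]$ for all $x$ and all states $\rho$. Then $\mathcal I_{\mathcal X}:=\sum_x\mathcal I_x$ is a channel. A measurement scheme is a tuple $\mathcal M=(\mathcal H_A,\xi,\mathcal E,\mathsf Z)$ consisting of: - a finite-dimensional Hilbert space $\mathcal H_A$; - a state $\xi$ on $\mathcal H_A$; - a channel $\mathcal E$ acting on $\mathcal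 L(\mathcal H_S\otimes\mathcal H_A)$; - a family $\mathsf Z=\{\mathsf Z_x\}_{x\in\mathcal X}$ of positive operators on $\mathcal H_A$ summing to $\mathbb 1$. It implements the instrument $\mathcal I_x(\rho)=\mathrm{tr}_A[(\mathbb 1\otimes\mathsf Z_x)\mathcal E(\rho\otimes\xi)]$, which is an $\mathsf E$-instrument for $\mathsf E_x=\mathcal I_x^*(\mathbb 1)$. The scheme is constrained by the third law if $\xi$ is full-rank and $\mathcal E$ is constrained by the third law. An $\mathsf E$-instrument $\mathcal I$ does not disturb an observable $\mathsf F=\{\mathsf F_y\}$ if $\mathrm{tr}[\mathsf F_y\mathcal I_{\mathcal X}(\rho)]=\mathrm{tr}[\mathsf F_y\rho]$ for all $y$ and all states $\rho$; equivalently, $\mathcal I_{\mathcal X}^*(\mathsf F_y)=\mathsf F_y$. The fixed-point set is $\mathcal F(\mathcal I_{\mathcal X}^* )=\{A:\mathcal I_{\mathcal X}^*(A)=A\}$. The commutant is $\mathsf E'=\{A\in\mathcal L(\mathcal H_S):[A,\mathsf E_x]=0\ \forall x\}$. *)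

theory Defs
  imports "Jordan_Normal_Form.Spectral_Radius" "Jordan_Normal_Form.Schur_Decomposition"
begin

text \<open>Operators on C^n are represented as n x n complex matrices (type complex mat).
  Tensor products C^n (x) C^m are identified with C^(n*m) via the index (i,k) |-> i*m + k
  (first factor = system, second factor = ancilla).\<close>

definition mtrace :: "complex mat \<Rightarrow> complex" where
  "mtrace A = (\<Sum>i<dim_row A. A $$ (i,i))"

definition msum :: "nat \<Rightarrow> ('x \<Rightarrow> complex mat) \<Rightarrow> 'x set \<Rightarrow> complex mat" where
  "msum n f X = mat n n (\<lambda>(i,j). \<Sum>x\<in>X. f x $$ (i,j))"

definition positive_op :: "nat \<Rightarrow> complex mat \<Rightarrow> bool" where
  "positive_op n A \<longleftrightarrow> A \<in> carrier_mat n n \<and>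
     (\<forall>v\<in>carrier_vec n. Im ((A *\<^sub>v v) \<bullet>c v) = 0 \<and> Re ((A *\<^sub>v v) \<bullet>c v) \<ge> 0)"

definition posdef_op :: "nat \<Rightarrow> complex mat \<Rightarrow> bool" where
  "posdef_op n A \<longleftrightarrow> A \<in> carrier_mat n n \<and>
     (\<forall>v\<in>carrier_vec n. v \<noteq> 0\<^sub>v n \<longrightarrow> Im ((A *\<^sub>v v) \<bullet>c v) = 0 \<and> Re ((A *\<^sub>v v) \<bullet>c v) > 0)"

definition is_state :: "nat \<Rightarrow> complex mat \<Rightarrow> bool" where
  "is_state n \<rho> \<longleftrightarrow> positive_op n \<rho> \<and> mtrace \<rho> = 1"

definition full_rank_state :: "nat \<Rightarrow> complex mat \<Rightarrow> bool" where
  "full_rank_state n \<rho> \<longleftrightarrow> is_state n \<rho> \<and> posdef_op n \<rho>"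

definition kron :: "complex mat \<Rightarrow> complex mat \<Rightarrow> complex mat" where
  "kron A B = mat (dim_row A * dim_row B) (dim_col A * dim_col B)
     (\<lambda>(i,j). A $$ (i div dim_row B, j div dim_col B) * B $$ (i mod dim_row B, j mod dim_col B))"

definition ptrace2 :: "nat \<Rightarrow> nat \<Rightarrow> complex mat \<Rightarrow> complex mat" where
  "ptrace2 n m M = mat n n (\<lambda>(i,j). \<Sum>k<m. M $$ (i*m + k, j*m + k))"

definition linear_map_op :: "nat \<Rightarrow> nat \<Rightarrow> (complex mat \<Rightarrow> complex mat) \<Rightarrow> bool" where
  "linear_map_op n k \<Phi> \<longleftrightarrow>
     (\<forall>A\<in>carrier_mat n n. \<Phi> A \<in> carrier_mat k k) \<and>
     (\<forall>A\<in>carrier_mat n n. \<forall>B\<in>carrier_mat n n. \<Phi> (A + B) = \<Phi> A + \<Phi> B) \<and>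
     (\<forall>c. \<forall>A\<in>carrier_mat n n. \<Phi> (c \<cdot>\<^sub>m A) = c \<cdot>\<^sub>m \<Phi> A)"

text \<open>(\<Phi> \<otimes> id_m) for \<Phi> : L(C^n) -> L(C^k), acting blockwise on L(C^n (x) C^m).\<close>
definition ampliate :: "nat \<Rightarrow> nat \<Rightarrow> nat \<Rightarrow> (complex mat \<Rightarrow> complex mat) \<Rightarrow> complex mat \<Rightarrow> complex mat" where
  "ampliate n k m \<Phi> X = mat (k*m) (k*m) (\<lambda>(p,q).
      \<Phi> (mat n n (\<lambda>(i,j). X $$ (i*m + p mod m, j*m + q mod m))) $$ (p div m, q div m))"

definition completely_positive :: "nat \<Rightarrow> nat \<Rightarrow> (complex mat \<Rightarrow> complex mat) \<Rightarrow> bool" where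
  "completely_positive n k \<Phi> \<longleftrightarrow> linear_map_op n k \<Phi> \<and>
     (\<forall>m. \<forall>X. positive_op (n*m) X \<longrightarrow> positive_op (k*m) (ampliate n k m \<Phi> X))"

definition is_channel :: "nat \<Rightarrow> nat \<Rightarrow> (complex mat \<Rightarrow> complex mat) \<Rightarrow> bool" where
  "is_channel n k \<Phi> \<longleftrightarrow> completely_positive n k \<Phi> \<and>
     (\<forall>A\<in>carrier_mat n n. mtrace (\<Phi> A) = mtrace A)"

definition dual_map :: "nat \<Rightarrow> nat \<Rightarrow> (complex mat \<Rightarrow> complex mat) \<Rightarrow> complex mat \<Rightarrow> complex mat" where
  "dual_map n k \<Phi> A = (THE D. D \<in> carrier_mat n n \<and>
      (\<forall>B\<in>carrier_mat n n. mtrace (D * B) = mtrace (A * \<Phi> B)))"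

definition third_law_channel :: "nat \<Rightarrow> nat \<Rightarrow> (complex mat \<Rightarrow> complex mat) \<Rightarrow> bool" where
  "third_law_channel n k \<Phi> \<longleftrightarrow> is_channel n k \<Phi> \<and>
     (\<forall>\<rho>. full_rank_state n \<rho> \<longrightarrow> full_rank_state k (\<Phi> \<rho>))"

definition is_observable :: "nat \<Rightarrow> 'x set \<Rightarrow> ('x \<Rightarrow> complex mat) \<Rightarrow> bool" where
  "is_observable d X E \<longleftrightarrow> finite X \<and>
     (\<forall>x\<in>X. E x \<noteq> 0\<^sub>m d d \<and> positive_op d (E x) \<and> positive_op d (1\<^sub>m d - E x)) \<and>
     msum d E X = 1\<^sub>m d"

definition nontrivial_obs :: "nat \<Rightarrow> 'x set \<Rightarrow> ('x \<Rightarrow> complex mat) \<Rightarrow> bool" where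
  "nontrivial_obs d X E \<longleftrightarrow> (\<exists>x\<in>X. \<not> (\<exists>c. E x = c \<cdot>\<^sub>m 1\<^sub>m d))"

definition completely_unsharp :: "'x set \<Rightarrow> ('x \<Rightarrow> complex mat) \<Rightarrow> bool" where
  "completely_unsharp X E \<longleftrightarrow> (\<forall>x\<in>X. 0 \<notin> spectrum (E x) \<and> 1 \<notin> spectrum (E x))"

definition vnorm :: "complex vec \<Rightarrow> real" where
  "vnorm v = sqrt (\<Sum>i<dim_vec v. (cmod (v $ i))\<^sup>2)"

definition op_norm :: "nat \<Rightarrow> complex mat \<Rightarrow> real" where
  "op_norm n A = (SUP v\<in>{v\<in>carrier_vec n. vnorm v = 1}. vnorm (A *\<^sub>v v))"

definition orth_projection :: "nat \<Rightarrow> complex mat \<Rightarrow> bool" where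
  "orth_projection n P \<longleftrightarrow> P \<in> carrier_mat n n \<and> P * P = P \<and> mat_adjoint P = P"

definition is_instrument :: "nat \<Rightarrow> 'x set \<Rightarrow> ('x \<Rightarrow> complex mat) \<Rightarrow> ('x \<Rightarrow> complex mat \<Rightarrow> complex mat) \<Rightarrow> bool" where
  "is_instrument d X E \<I> \<longleftrightarrow> (\<forall>x\<in>X. completely_positive d d (\<I> x)) \<and>
     (\<forall>x\<in>X. \<forall>\<rho>. is_state d \<rho> \<longrightarrow> mtrace (\<I> x \<rho>) = mtrace (E x * \<rho>))"

definition total_channel :: "nat \<Rightarrow> 'x set \<Rightarrow> ('x \<Rightarrow> complex mat \<Rightarrow> complex mat) \<Rightarrow> complex mat \<Rightarrow> complex mat" where
  "total_channel d X \<I> \<rho> = msum d (\<lambda>x. \<I> x \<rho>) X"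

definition third_law_scheme_implements :: "nat \<Rightarrow> 'x set \<Rightarrow> nat \<Rightarrow> complex mat \<Rightarrow>
    (complex mat \<Rightarrow> complex mat) \<Rightarrow> ('x \<Rightarrow> complex mat) \<Rightarrow> ('x \<Rightarrow> complex mat \<Rightarrow> complex mat) \<Rightarrow> bool" where
  "third_law_scheme_implements d X m \<xi> \<E> Z \<I> \<longleftrightarrow>
     0 < m \<and> is_state m \<xi> \<and> is_channel (d*m) (d*m) \<E> \<and>
     (\<forall>x\<in>X. positive_op m (Z x)) \<and> msum m Z X = 1\<^sub>m m \<and>
     (\<forall>x\<in>X. \<forall>\<rho>\<in>carrier_mat d d. \<I> x \<rho> = ptrace2 d m (kron (1\<^sub>m d) (Z x) * \<E> (kron \<rho> \<xi>))) \<and>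
     full_rank_state m \<xi> \<and> third_law_channel (d*m) (d*m) \<E>"

definition does_not_disturb :: "nat \<Rightarrow> 'x set \<Rightarrow> ('x \<Rightarrow> complex mat \<Rightarrow> complex mat) \<Rightarrow> 'y set \<Rightarrow> ('y \<Rightarrow> complex mat) \<Rightarrow> bool" where
  "does_not_disturb d X \<I> Y F \<longleftrightarrow> (\<forall>y\<in>Y. \<forall>\<rho>. is_state d \<rho> \<longrightarrow>
      mtrace (F y * total_channel d X \<I> \<rho>) = mtrace (F y * \<rho>))"

definition commutant :: "nat \<Rightarrow> 'x set \<Rightarrow> ('x \<Rightarrow> complex mat) \<Rightarrow> complex mat set" where
  "commutant d X E = {A\<in>carrier_mat d d. \<forall>x\<in>X. A * E x = E x * A}"

definition fixed_points :: "nat \<Rightarrow> (complex mat \<Rightarrow> complex mat) \<Rightarrow> complex mat set" where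
  "fixed_points d \<Phi> = {A\<in>carrier_mat d d. dual_map d d \<Phi> A = A}"

end

theory Submission
  imports Defs
begin

text \<open>
  (a) The Lueders instrument \<open>\<I>\<^sub>x(\<rho>) = \<surd>E\<^sub>x \<rho> \<surd>E\<^sub>x\<close> is implemented with a maximally mixed
  ancilla by the channel with Kraus operators \<open>\<surd>E\<^sub>x \<otimes> |x\<rangle>\<langle>k|\<close>, which measures and then
  writes the outcome into a reset pointer. Since all \<open>\<surd>E\<^sub>x\<close> are invertible, no nonzero vector
  is annihilated by the adjoints of all Kraus operators, so full rank is preserved.

  (b) Take for \<open>P\<close> the eigenprojection of \<open>E\<^sub>x\<close> for the eigenvalue 1; then \<open>E\<^sub>y P = 0\<close> for
  \<open>y \<noteq> x\<close>. Put \<open>W = 1 - Z\<^sub>x\<close> and \<open>M(B) = \<E>(B \<otimes> \<xi>)\<close>. The third law makes \<open>M(1)\<close> positive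
  definite, hence
  \<open>0 < tr[(P \<otimes> W) M(1)] \<le> tr[(1 \<otimes> W) M(P)] + tr[(P \<otimes> 1) M(1 - P)]\<close>.
  The first summand is \<open>tr[(1 - E\<^sub>x) P] = 0\<close>, so the second, which is
  \<open>tr[P \<I>\<^sub>X(1 - P)]\<close>, cannot vanish.
\<close>

text \<open>Statement (b) is at heart a probability argument. An input supported in \<open>P\<close>
  yields outcome \<open>x\<close> with certainty, so the joint event \<open>P \<otimes> W\<close>
  (system found in \<open>P\<close>, outcome other than \<open>x\<close>) can be fed only by the
  complementary part of the input. If that part never reaches \<open>P\<close>, the event has weight
  zero, whereas a positive definite output gives weight to every nonzero effect. Non-triviality is
  what keeps \<open>W\<close> nonzero. In (a) the obstacle is the ancilla: the textbook dilation of
  a Lueders instrument starts from a pure pointer, which is not full-rank once the pointer has more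
  than one level. Letting \<open>k\<close> run over all ancilla levels in the Kraus operators makes
  the output depend on the ancilla state only through its trace, so a mixed pointer does no harm.
  Both halves draw their operators from one functional calculus: the square root for (a), the
  indicator of the eigenvalue 1 for (b). Since \<open>f(A)\<close> commutes with everything that
  commutes with \<open>A\<close>, the roots inherit the commutation relations of the
  observable.\<close>

section \<open>Adjoints, entrywise products and the inner product\<close>

lemma mat_adjoint_dim [simp]:
  "dim_row (mat_adjoint A) = dim_col A" "dim_col (mat_adjoint A) = dim_row A"
  by (auto simp: mat_adjoint_def)

lemma mat_adjoint_carrier [simp]: "mat_adjoint A \<in> carrier_mat m n \<longleftrightarrow> A \<in> carrier_mat n m"
  unfolding carrier_mat_def by (simp add: conj_commute)

lemma mat_adjoint_index [simp]:
  "i < dim_col A \<Longrightarrow> j < dim_row A \<Longrightarrow> mat_adjoint A $$ (i,j) = conjugate (A $$ (j,i))"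
  unfolding mat_adjoint_def by (subst mat_of_rows_index) auto

lemma mat_adjoint_adjoint [simp]: "mat_adjoint (mat_adjoint (A :: complex mat)) = A"
  by (rule eq_matI) auto

lemma mult_mat_index_sum:
  "i < dim_row A \<Longrightarrow> j < dim_col B \<Longrightarrow> dim_col A = dim_row B \<Longrightarrow>
   (A * B) $$ (i,j) = (\<Sum>k<dim_row B. A $$ (i,k) * B $$ (k,j))"
  by (auto simp: scalar_prod_def lessThan_atLeast0)

lemma mult_mat_vec_index_sum:
  "i < dim_row A \<Longrightarrow> dim_col A = dim_vec v \<Longrightarrow>
   (A *\<^sub>v v) $ i = (\<Sum>k<dim_vec v. A $$ (i,k) * v $ k)"
  by (auto simp: scalar_prod_def lessThan_atLeast0)

lemma cscalar_prod_sum: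
  "dim_vec v = dim_vec w \<Longrightarrow> v \<bullet>c w = (\<Sum>i<dim_vec w. v $ i * cnj (w $ i))" for v w :: "complex vec"
  by (auto simp: scalar_prod_def lessThan_atLeast0)

lemma mat_adjoint_mult:
  "dim_col A = dim_row B \<Longrightarrow> mat_adjoint (A * B) = mat_adjoint B * mat_adjoint (A :: complex mat)"
  by (rule eq_matI) (auto simp: mult_mat_index_sum mult.commute simp del: index_mult_mat(1))

lemma mat_adjoint_one [simp]: "mat_adjoint (1\<^sub>m n :: complex mat) = 1\<^sub>m n"
  by (rule eq_matI) auto

lemma mat_adjoint_minus: "A \<in> carrier_mat n m \<Longrightarrow> B \<in> carrier_mat n m \<Longrightarrow>
  mat_adjoint (A - B) = mat_adjoint A - mat_adjoint (B :: complex mat)"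
  by (rule eq_matI) auto

lemma cscalar_prod_mult_mat_vec:
  assumes "A \<in> carrier_mat n m" "v \<in> carrier_vec m" "w \<in> carrier_vec n"
  shows "(A *\<^sub>v v) \<bullet>c w = v \<bullet>c (mat_adjoint (A :: complex mat) *\<^sub>v w)"
proof -
  have "(A *\<^sub>v v) \<bullet>c w = (\<Sum>i<n. \<Sum>k<m. A $$ (i,k) * v $ k * cnj (w $ i))"
    using assms by (simp add: cscalar_prod_sum mult_mat_vec_index_sum sum_distrib_right
        del: index_mult_mat_vec)
  also have "\<dots> = (\<Sum>k<m. \<Sum>i<n. A $$ (i,k) * v $ k * cnj (w $ i))"
    by (rule sum.swap)
  also have "\<dots> = v \<bullet>c (mat_adjoint A *\<^sub>v w)"
    using assms by (simp add: cscalar_prod_sum mult_mat_vec_index_sum sum_distrib_left ac_simps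
        del: index_mult_mat_vec)
  finally show ?thesis .
qed

lemma cscalar_prod_self:
  "(v :: complex vec) \<bullet>c v = complex_of_real (\<Sum>i<dim_vec v. (cmod (v $ i))\<^sup>2)"
  by (simp add: cscalar_prod_sum complex_norm_square del: of_real_power)

lemma cscalar_prod_self_real: "Im (v \<bullet>c v) = 0" "Re (v \<bullet>c v) \<ge> 0" for v :: "complex vec"
  unfolding cscalar_prod_self Im_complex_of_real Re_complex_of_real by (auto intro: sum_nonneg)

lemma cscalar_prod_self_pos:
  fixes v :: "complex vec"
  assumes "v \<in> carrier_vec n" "v \<noteq> 0\<^sub>v n"
  shows "Re (v \<bullet>c v) > 0"
proof -
  have "v \<bullet>c v \<noteq> 0" using assms by simp
  then have "Re (v \<bullet>c v) \<noteq> 0" by (auto simp: complex_eq_iff cscalar_prod_self_real(1))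
  then show ?thesis using cscalar_prod_self_real(2)[of v] by linarith
qed

subsection \<open>Traces\<close>

lemma mtrace_carrier: "A \<in> carrier_mat n n \<Longrightarrow> mtrace A = (\<Sum>i<n. A $$ (i,i))"
  by (simp add: mtrace_def)

lemma mtrace_add: "A \<in> carrier_mat n n \<Longrightarrow> B \<in> carrier_mat n n \<Longrightarrow> mtrace (A + B) = mtrace A + mtrace B"
  by (simp add: mtrace_def sum.distrib)

lemma mtrace_minus: "A \<in> carrier_mat n n \<Longrightarrow> B \<in> carrier_mat n n \<Longrightarrow> mtrace (A - B) = mtrace A - mtrace B"
  by (simp add: mtrace_def sum_subtractf)

lemma mtrace_smult: "A \<in> carrier_mat n n \<Longrightarrow> mtrace (c \<cdot>\<^sub>m A) = c * mtrace A"
  by (simp add: mtrace_def sum_distrib_left)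

lemma mtrace_mult_sum: "A \<in> carrier_mat n m \<Longrightarrow> B \<in> carrier_mat m n \<Longrightarrow>
  mtrace (A * B) = (\<Sum>i<n. \<Sum>k<m. A $$ (i,k) * B $$ (k,i))"
  by (simp add: mtrace_def mult_mat_index_sum del: index_mult_mat(1))

lemma mtrace_mult_commute:
  assumes "A \<in> carrier_mat n m" "B \<in> carrier_mat m n"
  shows "mtrace (A * B) = mtrace (B * A)"
  unfolding mtrace_mult_sum[OF assms] mtrace_mult_sum[OF assms(2,1)]
  by (subst sum.swap) (simp add: mult.commute)

section \<open>Matrix units and the trace pairing\<close>

text \<open>The operator |i><j|. It extracts matrix entries by traces here and later moves the
  pointer from level \<open>j\<close> to level \<open>i\<close>.\<close>

definition munit :: "nat \<Rightarrow> nat \<Rightarrow> nat \<Rightarrow> complex mat" where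
  "munit n i j = mat n n (\<lambda>(a,b). if a = i \<and> b = j then 1 else 0)"

lemma munit_carrier [simp]: "munit n i j \<in> carrier_mat n n"
  by (simp add: munit_def)

lemma munit_dim [simp]: "dim_row (munit n i j) = n" "dim_col (munit n i j) = n"
  by (simp_all add: munit_def)

lemma munit_index [simp]:
  "a < n \<Longrightarrow> b < n \<Longrightarrow> munit n i j $$ (a,b) = (if a = i \<and> b = j then 1 else 0)"
  by (simp add: munit_def)

lemma mtrace_mult_munit:
  assumes "D \<in> carrier_mat n n" "i < n" "j < n"
  shows "mtrace (D * munit n j i) = D $$ (i,j)"
proof -
  have "mtrace (D * munit n j i) = (\<Sum>a<n. \<Sum>b<n. if b = j then (if a = i then D $$ (a,b) else 0) else 0)"
    unfolding mtrace_mult_sum[OF assms(1) munit_carrier]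
    by (intro sum.cong refl) auto
  then show ?thesis using assms by simp
qed

text \<open>Testing against matrix units reads off every entry. This is the uniqueness half of the
  definite description in \<open>dual_map\<close>.\<close>

lemma mtrace_mult_nondegenerate:
  assumes "D \<in> carrier_mat n n" "D' \<in> carrier_mat n n"
    and "\<And>B. B \<in> carrier_mat n n \<Longrightarrow> mtrace (D * B) = mtrace (D' * B)"
  shows "D = D'"
  using assms by (intro eq_matI) (auto simp flip: mtrace_mult_munit)

text \<open>A linear functional is determined by its values on matrix units, and these values are
  the entries of the representing matrix. This is the existence half for
  \<open>dual_map\<close>.\<close>

lemma linear_functional_eq_mtrace:
  assumes add: "\<And>A B. A \<in> carrier_mat n n \<Longrightarrow> B \<in> carrier_mat n n \<Longrightarrow> f (A + B) = f A + (f B :: complex)"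
    and smult: "\<And>c A. A \<in> carrier_mat n n \<Longrightarrow> f (c \<cdot>\<^sub>m A) = c * f A"
  shows "\<exists>D\<in>carrier_mat n n. \<forall>B\<in>carrier_mat n n. mtrace (D * B) = f B"
proof -
  define D where "D = mat n n (\<lambda>(i,j). f (munit n j i))"
  have D: "D \<in> carrier_mat n n" by (simp add: D_def)
  \<comment> \<open>Additivity is given for two summands only, so a matrix is assembled entry by
    entry, by induction on the set \<open>S\<close> of positions already filled in.\<close>
  have *: "f (mat n n (\<lambda>p. if p \<in> S then B $$ p else 0))
      = (\<Sum>p\<in>S. B $$ p * f (munit n (fst p) (snd p)))"
    if "finite S" for S B
    using that
  proof (induction S rule: finite_induct)
    case empty
    \<comment> \<open>Writing the zero matrix as a multiple by the scalar 0 makes homogeneity yield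
      the value 0.\<close>
    have "mat n n (\<lambda>p. if p \<in> {} then B $$ p else 0) = 0 \<cdot>\<^sub>m (0\<^sub>m n n :: complex mat)"
      by (rule eq_matI) auto
    then show ?case by (simp only: smult[OF zero_carrier_mat]) simp
  next
    case (insert p S)
    have eq: "mat n n (\<lambda>q. if q \<in> insert p S then B $$ q else 0)
      = B $$ p \<cdot>\<^sub>m munit n (fst p) (snd p) + mat n n (\<lambda>q. if q \<in> S then B $$ q else 0)"
      using insert(2) by (intro eq_matI) auto
    show ?case unfolding eq using insert by (subst add) (auto simp: smult)
  qed
  have "mtrace (D * B) = f B" if B: "B \<in> carrier_mat n n" for B
  proof -
    have "mtrace (D * B) = (\<Sum>i<n. \<Sum>k<n. f (munit n k i) * B $$ (k,i))"
      using B D by (simp add: mtrace_mult_sum[OF D B]) (simp add: D_def)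
    also have "\<dots> = (\<Sum>k<n. \<Sum>i<n. B $$ (k,i) * f (munit n k i))"
      by (subst sum.swap) (simp add: mult.commute)
    also have "\<dots> = (\<Sum>p\<in>{..<n}\<times>{..<n}. B $$ p * f (munit n (fst p) (snd p)))"
      by (simp add: sum.cartesian_product case_prod_beta)
    also have "\<dots> = f (mat n n (\<lambda>p. if p \<in> {..<n}\<times>{..<n} then B $$ p else 0))"
      by (subst *) auto
    also have "mat n n (\<lambda>p. if p \<in> {..<n}\<times>{..<n} then B $$ p else 0) = B"
      using B by (intro eq_matI) auto
    finally show ?thesis .
  qed
  then show ?thesis using D by blast
qed

section \<open>Dual maps\<close>

lemma dual_map_eqI:
  assumes "D \<in> carrier_mat n n"
    and "\<And>B. B \<in> carrier_mat n n \<Longrightarrow> mtrace (D * B) = mtrace (A * \<Phi> B)"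
  shows "dual_map n k \<Phi> A = D"
  unfolding dual_map_def
  using assms by (intro the_equality) (auto intro!: mtrace_mult_nondegenerate)

lemma mtrace_dual_map:
  assumes \<Phi>: "linear_map_op n k \<Phi>" and A: "A \<in> carrier_mat k k" and B: "B \<in> carrier_mat n n"
  shows "mtrace (dual_map n k \<Phi> A * B) = mtrace (A * \<Phi> B)"
proof -
  have "\<exists>D\<in>carrier_mat n n. \<forall>B\<in>carrier_mat n n. mtrace (D * B) = mtrace (A * \<Phi> B)"
  proof (rule linear_functional_eq_mtrace)
    fix X Y :: "complex mat" assume XY: "X \<in> carrier_mat n n" "Y \<in> carrier_mat n n"
    then have "\<Phi> X \<in> carrier_mat k k" "\<Phi> Y \<in> carrier_mat k k" "\<Phi> (X + Y) = \<Phi> X + \<Phi> Y"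
      using \<Phi> unfolding linear_map_op_def by blast+
    then show "mtrace (A * \<Phi> (X + Y)) = mtrace (A * \<Phi> X) + mtrace (A * \<Phi> Y)"
      using A by (simp add: mult_add_distrib_mat[of _ k k _ k] mtrace_add[of _ k])
  next
    fix X :: "complex mat" and c assume X: "X \<in> carrier_mat n n"
    then have "\<Phi> X \<in> carrier_mat k k" "\<Phi> (c \<cdot>\<^sub>m X) = c \<cdot>\<^sub>m \<Phi> X"
      using \<Phi> unfolding linear_map_op_def by blast+
    then show "mtrace (A * \<Phi> (c \<cdot>\<^sub>m X)) = c * mtrace (A * \<Phi> X)"
      using A by (simp add: mult_smult_distrib[of _ k k _ k] mtrace_smult[of _ k])
  qed
  then obtain D where "D \<in> carrier_mat n n" "\<And>B. B \<in> carrier_mat n n \<Longrightarrow> mtrace (D * B) = mtrace (A * \<Phi> B)"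
    by blast
  then show ?thesis using dual_map_eqI[of D n A \<Phi> k] B by simp
qed

text \<open>Phrased with dimensions instead of carriers, so that the simplifier can discharge the
  side conditions without guessing the sizes.\<close>

lemma assoc_mult_mat_dim:
  "dim_col A = dim_row B \<Longrightarrow> dim_col B = dim_row C \<Longrightarrow> (A * B) * C = A * (B * (C :: 'a :: semiring_0 mat))"
  by (rule assoc_mult_mat[of A "dim_row A" "dim_row B" B "dim_row C" C "dim_col C"]) (auto intro: carrier_matI)

subsection \<open>Spectral calculus of Hermitian matrices\<close>

text \<open>The last conjunct records that a superdiagonal 1 never joins two Jordan blocks, so the
  eigenvalues on either side of it agree.\<close>

lemma jordan_matrix_bidiagonal:
  assumes "i < sum_list (map fst n_as)" "j < sum_list (map fst n_as)"
    and "jordan_matrix n_as $$ (i,j) \<noteq> (0 :: 'a :: {zero_neq_one})" "i \<noteq> j"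
  shows "j = Suc i \<and> jordan_matrix n_as $$ (i,j) = 1 \<and>
    jordan_matrix n_as $$ (i,i) = jordan_matrix n_as $$ (j,j)"
  using assms
proof (induction n_as arbitrary: i j)
  case Nil
  then show ?case by simp
next
  case (Cons na n_as)
  obtain n a where na: "na = (n,a)" by force
  let ?J = "jordan_matrix n_as"
  have J: "jordan_matrix (na # n_as) = four_block_mat (jordan_block n a)
      (0\<^sub>m n (sum_list (map fst n_as))) (0\<^sub>m (sum_list (map fst n_as)) n) ?J"
    using jordan_matrix_dim[of n_as]
    by (simp add: jordan_matrix_def na Let_def)
  have ix: "jordan_matrix (na # n_as) $$ (p,q) = (if p < n then if q < n then
       (if p = q then a else if Suc p = q then 1 else 0) else 0 else if q < n then 0 else ?J $$ (p - n, q - n))"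
    if "p < n + sum_list (map fst n_as)" "q < n + sum_list (map fst n_as)" for p q
    unfolding J using that by (auto simp: not_less)
  have ij: "i < n + sum_list (map fst n_as)" "j < n + sum_list (map fst n_as)"
    using Cons.prems na by auto
  show ?case
  proof (cases "i < n")
    case True
    then show ?thesis using Cons.prems(3,4) ij by (auto simp: ix split: if_splits)
  next
    case False
    then have jn: "\<not> j < n" using Cons.prems(3) ij by (auto simp: ix)
    have "j - n = Suc (i - n) \<and> ?J $$ (i-n,j-n) = 1 \<and> ?J $$ (i-n,i-n) = ?J $$ (j-n,j-n)"
    proof (rule Cons.IH)
      show "?J $$ (i-n,j-n) \<noteq> 0" using Cons.prems(3) False jn ij by (simp add: ix)
    qed (use False jn ij Cons.prems(4) in auto)
    then show ?thesis using False jn ij by (auto simp: ix)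
  qed
qed

text \<open>The diagonal entry is the squared length of column \<open>i\<close> of \<open>P\<close>,
  and a matrix with a left inverse has no zero column.\<close>

lemma gram_diag_pos:
  fixes P Q :: "complex mat"
  assumes P: "P \<in> carrier_mat n n" and Q: "Q \<in> carrier_mat n n" and QP: "Q * P = 1\<^sub>m n" and i: "i < n"
  shows "(mat_adjoint P * P) $$ (i,i) \<noteq> 0"
proof
  assume "(mat_adjoint P * P) $$ (i,i) = 0"
  then have "(\<Sum>k<n. cnj (P $$ (k,i)) * P $$ (k,i)) = 0"
    using P i by (simp add: mult_mat_index_sum del: index_mult_mat(1))
  then have "complex_of_real (\<Sum>k<n. (cmod (P $$ (k,i)))\<^sup>2) = 0"
    by (simp add: complex_norm_square mult.commute del: of_real_power)
  then have "(\<Sum>k<n. (cmod (P $$ (k,i)))\<^sup>2) = 0"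
    by (simp only: of_real_eq_0_iff)
  then have z: "\<And>k. k < n \<Longrightarrow> P $$ (k,i) = 0"
    by (subst (asm) sum_nonneg_eq_0_iff) auto
  have "(Q * P) $$ (i,i) = 0"
    using P Q i z by (simp add: mult_mat_index_sum del: index_mult_mat(1))
  then show False using QP i by simp
qed

text \<open>The columns of \<open>P\<close> are not orthonormal; \<open>gram\<close> suffices to make \<open>P f(D) Q\<close> Hermitian.\<close>
locale hermitian_eigenbasis =
  fixes n :: nat and A P Q :: "complex mat" and l :: "nat \<Rightarrow> real"
  assumes P: "P \<in> carrier_mat n n" and Q: "Q \<in> carrier_mat n n"
    and PQ: "P * Q = 1\<^sub>m n" and QP: "Q * P = 1\<^sub>m n"
    and A_eq: "A = P * mat_diag n (\<lambda>i. complex_of_real (l i)) * Q"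
    and gram: "\<And>i j. i < n \<Longrightarrow> j < n \<Longrightarrow> l i \<noteq> l j \<Longrightarrow> (mat_adjoint P * P) $$ (i,j) = 0"

lemma hermitian_eigenbasis_exists:
  assumes A: "(A :: complex mat) \<in> carrier_mat n n" and herm: "mat_adjoint A = A"
  shows "\<exists>P Q l. hermitian_eigenbasis n A P Q l"
proof -
  \<comment> \<open>With \<open>A = P J Q\<close> in Jordan form and \<open>G = P\<^sup>* P\<close>, hermiticity gives \<open>G J = J\<^sup>* G\<close>. Reading off
    the entries at the first nonzero superdiagonal entry of \<open>J\<close> yields \<open>G\<^sub>k\<^sub>k = 0\<close>, a contradiction.\<close>
  from char_poly_factorized[OF A] jordan_nf_exists[OF A] obtain n_as where "jordan_nf A n_as"
    by metis
  then obtain P Q where wit: "similar_mat_wit A (jordan_matrix n_as) P Q"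
    unfolding jordan_nf_def similar_mat_def by auto
  define J where "J = jordan_matrix n_as"
  from wit A have J: "J \<in> carrier_mat n n" and P: "P \<in> carrier_mat n n" and Q: "Q \<in> carrier_mat n n"
    and PQ: "P * Q = 1\<^sub>m n" and QP: "Q * P = 1\<^sub>m n" and AJ: "A = P * J * Q"
    by (auto simp: similar_mat_wit_def Let_def J_def)
  have n: "n = sum_list (map fst n_as)" using J by (auto simp: J_def)
  have bidiag: "j = Suc i \<and> J $$ (i,j) = 1 \<and> J $$ (i,i) = J $$ (j,j)"
    if "i < n" "j < n" "J $$ (i,j) \<noteq> 0" "i \<noteq> j" for i j
    using jordan_matrix_bidiagonal[of i n_as j] that unfolding J_def n by blast
  define G where "G = mat_adjoint P * P"
  have G: "G \<in> carrier_mat n n" using P by (auto simp: G_def)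
  have AP: "A * P = P * J"
    using P Q J by (simp add: AJ assoc_mult_mat_dim QP)
  have "G * J = mat_adjoint P * (A * P)"
    using P J A by (simp add: G_def AP assoc_mult_mat_dim)
  also have "\<dots> = mat_adjoint (P * J) * P"
    using P A J by (simp add: assoc_mult_mat_dim mat_adjoint_mult herm flip: AP)
  also have "\<dots> = mat_adjoint J * G"
    using P J by (simp add: mat_adjoint_mult assoc_mult_mat_dim G_def)
  finally have GJ: "G * J = mat_adjoint J * G" .
  have GJ': "(\<Sum>c<n. G $$ (a,c) * J $$ (c,b)) = (\<Sum>c<n. cnj (J $$ (c,a)) * G $$ (c,b))"
    if "a < n" "b < n" for a b
    using arg_cong[OF GJ, of "\<lambda>M. M $$ (a,b)"] that G J
    by (simp add: mult_mat_index_sum del: index_mult_mat(1))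
  have Gpos: "G $$ (i,i) \<noteq> 0" if "i < n" for i
    using gram_diag_pos[OF P Q QP that] by (simp add: G_def)
  have single: "(\<Sum>c<n. f c * J $$ (c,i)) = f i * J $$ (i,i)" "(\<Sum>c<n. cnj (J $$ (c,i)) * f c) = cnj (J $$ (i,i)) * f i"
    if "i < n" "\<And>k. k < n \<Longrightarrow> k \<noteq> i \<Longrightarrow> J $$ (k,i) = 0" for i f
    using that by (subst sum.remove[of _ i]; auto intro!: sum.neutral)+
  have offdiag: "J $$ (i,j) = 0" if "i < n" "j < n" "i \<noteq> j" for i j
  proof (rule ccontr)
    assume "J $$ (i,j) \<noteq> 0"
    then have ex: "\<exists>i. Suc i < n \<and> J $$ (i, Suc i) \<noteq> 0" using bidiag that by blast
    define k where "k = (LEAST i. Suc i < n \<and> J $$ (i, Suc i) \<noteq> 0)"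
    have k: "Suc k < n" "J $$ (k, Suc k) \<noteq> 0" using LeastI_ex[OF ex] by (auto simp: k_def)
    have least: "\<And>i. i < k \<Longrightarrow> J $$ (i, Suc i) = 0"
      using not_less_Least k(1) unfolding k_def by fastforce
    \<comment> \<open>Minimality of \<open>k\<close> leaves only the diagonal entry in column
      \<open>k\<close>. The (k,k) entry of \<open>GJ\<close> then shows that this eigenvalue is
      real.\<close>
    have col: "J $$ (c,k) = 0" if "c < n" "c \<noteq> k" for c
      using bidiag[of c k] that k least[of c] by fastforce
    have J1: "J $$ (k, Suc k) = 1" "J $$ (Suc k, Suc k) = J $$ (k,k)"
      using bidiag[of k "Suc k"] k by auto
    have real: "cnj (J $$ (k,k)) = J $$ (k,k)"
      using GJ'[of k k] single[OF _ col] k Gpos[of k] by simp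
    \<comment> \<open>Column \<open>Suc k\<close> holds just the 1 in row \<open>k\<close> and the
      eigenvalue below it. Comparing both sides of \<open>GJ'\<close>, the two eigenvalue terms
      cancel by reality and \<open>G $$ (k,k)\<close> is left over.\<close>
    have "(\<Sum>c<n. G $$ (k,c) * J $$ (c, Suc k)) = (\<Sum>c\<in>{k, Suc k}. G $$ (k,c) * J $$ (c, Suc k))"
    proof (rule sum.mono_neutral_right)
      have "J $$ (c, Suc k) = 0" if "c < n" "c \<noteq> k" "c \<noteq> Suc k" for c
        using bidiag[of c "Suc k"] that k by auto
      then show "\<forall>c\<in>{..<n} - {k, Suc k}. G $$ (k,c) * J $$ (c, Suc k) = 0" by auto
    qed (use k in auto)
    then have "G $$ (k,k) + G $$ (k, Suc k) * J $$ (k,k) = cnj (J $$ (k,k)) * G $$ (k, Suc k)"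
      using GJ'[of k "Suc k"] single(2)[OF _ col] k J1 by simp
    then show False using real Gpos[of k] k by simp
  qed
  define l where "l i = Re (J $$ (i,i))" for i
  have real: "J $$ (i,i) = complex_of_real (l i)" if "i < n" for i
    using GJ'[OF that that] single[OF that offdiag] Gpos[OF that] that
    by (auto simp: l_def complex_eq_iff)
  have "hermitian_eigenbasis n A P Q l"
  proof
    have "J = mat_diag n (\<lambda>i. complex_of_real (l i))"
      using J offdiag real by (intro eq_matI) (auto simp: mat_diag_def)
    then show "A = P * mat_diag n (\<lambda>i. complex_of_real (l i)) * Q" by (simp add: AJ)
    fix i j assume ij: "i < n" "j < n" "l i \<noteq> l j"
    \<comment> \<open>For diagonal real \<open>J\<close> this says that \<open>G $$ (i,j)\<close>
      times \<open>l j - l i\<close> is zero: eigenvectors for distinct eigenvalues are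
      orthogonal.\<close>
    have "G $$ (i,j) * J $$ (j,j) = cnj (J $$ (i,i)) * G $$ (i,j)"
      using GJ'[OF ij(1,2)] single[OF ij(2) offdiag] single[OF ij(1) offdiag] ij by simp
    then show "(mat_adjoint P * P) $$ (i,j) = 0"
      using real ij by (auto simp flip: G_def)
  qed (use P Q PQ QP in auto)
  then show ?thesis by blast
qed

section \<open>Real functional calculus\<close>

context hermitian_eigenbasis
begin

abbreviation D :: "(real \<Rightarrow> real) \<Rightarrow> complex mat" where
  "D f \<equiv> mat_diag n (\<lambda>i. complex_of_real (f (l i)))"

text \<open>This is \<open>f(A)\<close>. Restricting \<open>f\<close> to real values makes every
  \<open>F f\<close> Hermitian.\<close>

definition F :: "(real \<Rightarrow> real) \<Rightarrow> complex mat" where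
  "F f = P * D f * Q"

lemma D_dim [simp]: "dim_row (mat_diag n f) = n" "dim_col (mat_diag n f) = n"
  by (simp_all add: mat_diag_def)

lemma F_carrier [simp]: "F f \<in> carrier_mat n n"
  using P Q by (auto simp: F_def intro: carrier_matI)

lemma F_dim [simp]: "dim_row (F f) = n" "dim_col (F f) = n"
  using F_carrier[of f] by (auto simp del: F_carrier)

lemma F_id: "F (\<lambda>x. x) = A"
  by (simp add: F_def A_eq)

lemma F_one: "F (\<lambda>x. 1) = 1\<^sub>m n"
  using P by (simp add: F_def PQ)

lemma QPX: "dim_row X = n \<Longrightarrow> Q * (P * X) = X"
  using P Q by (metis QP assoc_mult_mat_dim carrier_matD left_mult_one_mat')

lemma PQX: "dim_row X = n \<Longrightarrow> P * (Q * X) = X"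
  using P Q by (metis PQ assoc_mult_mat_dim carrier_matD left_mult_one_mat')

lemma F_mult: "F f * F g = F (\<lambda>x. f x * g x)"
proof -
  have "F f * F g = P * (D f * (D g * Q))"
    using P Q by (simp add: F_def assoc_mult_mat_dim QPX)
  also have "D f * (D g * Q) = (D f * D g) * Q"
    using Q by (simp add: assoc_mult_mat_dim del: mat_diag_diag)
  finally show ?thesis using P Q by (simp add: F_def assoc_mult_mat_dim)
qed

text \<open>The Gram matrix \<open>G\<close> of the columns of \<open>P\<close> has entries only
  between equal eigenvalues, hence commutes with \<open>D f\<close>. Moving \<open>D f\<close>
  across \<open>G\<close> turns the adjoint of \<open>P * D f * Q\<close> back into itself, although
  \<open>P\<close> need not be unitary.\<close>

lemma F_adjoint: "mat_adjoint (F f) = F f"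
proof -
  define G where "G = mat_adjoint P * P"
  have G: "G \<in> carrier_mat n n" using P by (auto simp: G_def)
  have GD: "G * D f = D f * G"
  proof -
    have "G $$ (i,j) * complex_of_real (f (l j)) = complex_of_real (f (l i)) * G $$ (i,j)"
      if "i < n" "j < n" for i j
      using gram[OF that] by (cases "l i = l j") (auto simp: G_def)
    then show ?thesis
      unfolding mat_diag_mult_left[OF G] mat_diag_mult_right[OF G] by (intro cong_mat) auto
  qed
  have D: "mat_adjoint (D f) = D f" by (rule eq_matI) (auto simp: mat_diag_def)
  have QaPa: "mat_adjoint Q * mat_adjoint P = 1\<^sub>m n"
    using P Q PQ by (simp flip: mat_adjoint_mult)
  have "mat_adjoint (F f) = mat_adjoint Q * (D f * (mat_adjoint P * (P * Q)))"
    using P Q by (simp add: F_def mat_adjoint_mult assoc_mult_mat_dim D PQ)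
  also have "\<dots> = mat_adjoint Q * ((D f * G) * Q)"
    using P Q by (simp add: G_def assoc_mult_mat_dim)
  also have "\<dots> = mat_adjoint Q * (mat_adjoint P * F f)"
    using P Q by (simp flip: GD) (simp add: G_def F_def assoc_mult_mat_dim)
  also have "\<dots> = (mat_adjoint Q * mat_adjoint P) * F f"
    using P Q by (simp add: assoc_mult_mat_dim)
  finally show ?thesis by (simp add: QaPa)
qed

lemma F_add: "F f + F g = F (\<lambda>x. f x + g x)"
proof -
  have "D (\<lambda>x. f x + g x) = D f + D g"
    by (rule eq_matI) (auto simp: mat_diag_def)
  moreover have "P * (D f + D g) * Q = P * D f * Q + P * D g * Q"
    unfolding mult_add_distrib_mat[OF P mat_diag_dim mat_diag_dim]
    by (rule add_mult_distrib_mat[of _ n n]) (use P Q in \<open>auto intro: carrier_matI\<close>)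
  ultimately show ?thesis by (simp add: F_def)
qed

lemma F_cong: "(\<And>i. i < n \<Longrightarrow> f (l i) = g (l i)) \<Longrightarrow> F f = F g"
  unfolding F_def mat_diag_def by (intro arg_cong[of _ _ "\<lambda>X. P * X * Q"] cong_mat) auto

lemma F_minus: "F f - F g = F (\<lambda>x. f x - g x)"
proof -
  have "F f = F (\<lambda>x. f x - g x) + F g" by (simp add: F_add)
  then show ?thesis by (intro eq_matI) auto
qed

text \<open>In the eigenbasis, commuting with \<open>A\<close> means that the (i,j) entry vanishes
  unless \<open>l i = l j\<close>. Such a matrix commutes with every \<open>D f\<close>.\<close>

lemma F_commute:
  assumes B: "B \<in> carrier_mat n n" and BA: "B * A = A * B"
  shows "B * F f = F f * B"
proof -
  define B' where "B' = Q * B * P"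
  have B': "B' \<in> carrier_mat n n" using P Q B by (auto simp: B'_def)
  let ?D = "mat_diag n (\<lambda>i. complex_of_real (l i))"
  have BB': "B = P * B' * Q"
    using P Q B by (simp add: B'_def assoc_mult_mat_dim PQX PQ)
  have QA: "Q * A = ?D * Q" using P Q by (simp add: A_eq assoc_mult_mat_dim QPX)
  have AP: "A * P = P * ?D" using P Q by (simp add: A_eq assoc_mult_mat_dim QP)
  have Ac: "dim_row A = n" "dim_col A = n" using P Q by (simp_all add: A_eq)
  have "B' * ?D = Q * (B * A) * P"
    using P Q B Ac by (simp add: B'_def assoc_mult_mat_dim AP)
  also have "\<dots> = (Q * A) * B * P" using P Q B Ac by (simp add: BA assoc_mult_mat_dim)
  also have "\<dots> = ?D * B'"
    using P Q B Ac by (simp add: QA) (simp add: B'_def assoc_mult_mat_dim)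
  finally have eq: "B' * ?D = ?D * B'" .
  have "B' $$ (i,j) * complex_of_real (f (l j)) = complex_of_real (f (l i)) * B' $$ (i,j)"
    if "i < n" "j < n" for i j
    using arg_cong[OF eq, of "\<lambda>M. M $$ (i,j)"] that
    by (auto simp: mat_diag_mult_left[OF B'] mat_diag_mult_right[OF B'])
  then have "B' * D f = D f * B'"
    by (auto simp: mat_diag_mult_left[OF B'] mat_diag_mult_right[OF B'] intro!: cong_mat)
  then have "P * (B' * D f) * Q = P * (D f * B') * Q" by simp
  then show ?thesis using P Q B'
    unfolding BB' F_def by (simp add: assoc_mult_mat_dim QPX)
qed

lemma eigenvector_col:
  assumes i: "i < n"
  shows "F f *\<^sub>v col P i = complex_of_real (f (l i)) \<cdot>\<^sub>v col P i"
proof -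
  have "F f *\<^sub>v col P i = col (F f * P) i" using P i by (simp add: col_mult2[of _ n n _ n])
  also have "F f * P = P * D f" using P Q by (simp add: F_def assoc_mult_mat_dim QP)
  also have "col (P * D f) i = complex_of_real (f (l i)) \<cdot>\<^sub>v col P i"
    using P i by (intro eq_vecI) (auto simp: mat_diag_mult_right[OF P])
  finally show ?thesis .
qed

lemma col_nonzero:
  assumes i: "i < n"
  shows "col P i \<noteq> 0\<^sub>v n"
proof
  assume z: "col P i = 0\<^sub>v n"
  have "(Q * P) $$ (i,i) = row Q i \<bullet> col P i" using P Q i by simp
  then show False using i Q by (simp add: QP z)
qed

end

subsection \<open>Positive operators\<close>

lemma positive_op_carrier: "positive_op n A \<Longrightarrow> A \<in> carrier_mat n n"
  by (simp add: positive_op_def)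

text \<open>\<open>positive_op\<close> speaks about the quadratic form only, so hermiticity is
  recovered by polarization, with the form evaluated at e_i + c e_j.\<close>

lemma positive_op_adjoint:
  assumes "positive_op n A"
  shows "mat_adjoint A = A"
proof -
  have A: "A \<in> carrier_mat n n" using assms by (rule positive_op_carrier)
  have form: "A $$ (i,i) + c * A $$ (i,j) + cnj c * (A $$ (j,i) + c * A $$ (j,j)) \<in> \<real>"
    if ij: "i < n" "j < n" for i j and c :: complex
  proof -
    \<comment> \<open>Adding two indicators keeps the formula valid for \<open>i = j\<close>, which
      is used below for the diagonal entries.\<close>
    define v where "v = vec n (\<lambda>k. (if k = i then 1 else 0) + (if k = j then c else 0))"
    have v: "v \<in> carrier_vec n" by (simp add: v_def)
    have sv: "(\<Sum>k<n. f k * v $ k) = f i + c * f j"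
         "(\<Sum>k<n. f k * cnj (v $ k)) = f i + cnj c * f j" for f
    proof -
      have "(\<Sum>k<n. f k * v $ k) = (\<Sum>k<n. (if k = i then f k else 0) + (if k = j then c * f k else 0))"
        by (intro sum.cong) (auto simp: v_def algebra_simps)
      then show "(\<Sum>k<n. f k * v $ k) = f i + c * f j" using ij by (simp add: sum.distrib)
      have "(\<Sum>k<n. f k * cnj (v $ k))
          = (\<Sum>k<n. (if k = i then f k else 0) + (if k = j then cnj c * f k else 0))"
        by (intro sum.cong) (auto simp: v_def algebra_simps)
      then show "(\<Sum>k<n. f k * cnj (v $ k)) = f i + cnj c * f j" using ij by (simp add: sum.distrib)
    qed
    have "(A *\<^sub>v v) \<bullet>c v = (\<Sum>a<n. (\<Sum>b<n. A $$ (a,b) * v $ b) * cnj (v $ a))"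
      using A v by (simp add: cscalar_prod_sum mult_mat_vec_index_sum del: index_mult_mat_vec)
    also have "\<dots> = A $$ (i,i) + c * A $$ (i,j) + cnj c * (A $$ (j,i) + c * A $$ (j,j))"
      by (simp add: sv)
    finally have eq: "(A *\<^sub>v v) \<bullet>c v = A $$ (i,i) + c * A $$ (i,j) + cnj c * (A $$ (j,i) + c * A $$ (j,j))" .
    have "Im ((A *\<^sub>v v) \<bullet>c v) = 0"
      using assms v by (simp add: positive_op_def)
    then show ?thesis unfolding eq complex_is_Real_iff .
  qed
  show ?thesis
  proof (rule eq_matI)
    fix i j assume "i < dim_row A" "j < dim_col A"
    then have ij: "i < n" "j < n" using A by auto
    have d: "Im (A $$ (i,i)) = 0" "Im (A $$ (j,j)) = 0"
      using form[of i i 0] form[of j j 0] ij by (auto simp: complex_is_Real_iff)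
    \<comment> \<open>With a real diagonal, c = 1 controls the imaginary parts of the two mirrored
      entries and c = \<i> their real parts.\<close>
    have "Im (A $$ (i,j)) + Im (A $$ (j,i)) = 0"
      using form[of i j 1] d ij by (simp add: complex_is_Real_iff)
    moreover have "Re (A $$ (i,j)) - Re (A $$ (j,i)) = 0"
      using form[of i j \<i>] d ij by (simp add: complex_is_Real_iff)
    ultimately show "mat_adjoint A $$ (i,j) = A $$ (i,j)"
      using A ij by (simp add: complex_eq_iff)
  qed (use A in auto)
qed

lemma posdef_op_positive: "posdef_op n A \<Longrightarrow> positive_op n A"
proof -
  assume A: "posdef_op n A"
  have "Im ((A *\<^sub>v v) \<bullet>c v) = 0 \<and> Re ((A *\<^sub>v v) \<bullet>c v) \<ge> 0" if "v \<in> carrier_vec n" for v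
    using A that by (cases "v = 0\<^sub>v n") (auto simp: posdef_op_def less_imp_le)
  then show ?thesis using A by (auto simp: positive_op_def posdef_op_def)
qed

lemma positive_op_conj:
  assumes X: "positive_op n X" and K: "K \<in> carrier_mat k n"
  shows "positive_op k (K * X * mat_adjoint K)"
proof -
  have Xc: "X \<in> carrier_mat n n" using X by (rule positive_op_carrier)
  have "((K * X * mat_adjoint K) *\<^sub>v v) \<bullet>c v = (X *\<^sub>v (mat_adjoint K *\<^sub>v v)) \<bullet>c (mat_adjoint K *\<^sub>v v)"
    if v: "v \<in> carrier_vec k" for v
  proof -
    have w: "mat_adjoint K *\<^sub>v v \<in> carrier_vec n" using K v by (auto intro: mult_mat_vec_carrier)
    have "(K * X * mat_adjoint K) *\<^sub>v v = K *\<^sub>v (X *\<^sub>v (mat_adjoint K *\<^sub>v v))"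
      using K Xc v w
      by (simp add: assoc_mult_mat_vec[of _ k n _ k] assoc_mult_mat_vec[of _ k n _ n])
    then show ?thesis
      using cscalar_prod_mult_mat_vec[OF K _ v, of "X *\<^sub>v (mat_adjoint K *\<^sub>v v)"] Xc w by simp
  qed
  moreover have "mat_adjoint K *\<^sub>v v \<in> carrier_vec n" if "v \<in> carrier_vec k" for v
    using K that by (auto intro: mult_mat_vec_carrier)
  ultimately show ?thesis
    using X Xc K unfolding positive_op_def by (auto intro: carrier_matI)
qed

lemma positive_op_one [simp]: "positive_op n (1\<^sub>m n)"
  using cscalar_prod_self_real by (auto simp: positive_op_def)

lemma posdef_op_one [simp]: "posdef_op n (1\<^sub>m n)"
  using cscalar_prod_self_real cscalar_prod_self_pos by (auto simp: posdef_op_def)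

lemma positive_op_square:
  assumes "S \<in> carrier_mat n n" "mat_adjoint S = S"
  shows "positive_op n (S * S)"
  using positive_op_conj[OF positive_op_one assms(1)] assms by simp

lemma cscalar_prod_add_mat:
  assumes "A \<in> carrier_mat n n" "B \<in> carrier_mat n n" "v \<in> carrier_vec n"
  shows "((A + B) *\<^sub>v v) \<bullet>c v = (A *\<^sub>v v) \<bullet>c v + (B *\<^sub>v v) \<bullet>c (v :: complex vec)"
  using assms by (simp add: add_mult_distrib_mat_vec[of _ n n] add_scalar_prod_distrib[of _ n])

lemma cscalar_prod_smult_mat:
  assumes "A \<in> carrier_mat n n" "v \<in> carrier_vec n"
  shows "((c \<cdot>\<^sub>m A) *\<^sub>v v) \<bullet>c v = c * ((A *\<^sub>v v) \<bullet>c (v :: complex vec))"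
proof -
  have "(c \<cdot>\<^sub>m A) *\<^sub>v v = c \<cdot>\<^sub>v (A *\<^sub>v v)" using assms by (intro eq_vecI) auto
  then show ?thesis using assms by simp
qed

lemma positive_op_add: "positive_op n A \<Longrightarrow> positive_op n B \<Longrightarrow> positive_op n (A + B)"
  by (auto simp: positive_op_def cscalar_prod_add_mat)

lemma positive_op_smult: "positive_op n A \<Longrightarrow> r \<ge> 0 \<Longrightarrow> positive_op n (complex_of_real r \<cdot>\<^sub>m A)"
  by (auto simp: positive_op_def cscalar_prod_smult_mat)

lemma posdef_op_smult: "posdef_op n A \<Longrightarrow> r > 0 \<Longrightarrow> posdef_op n (complex_of_real r \<cdot>\<^sub>m A)"
  by (auto simp: posdef_op_def cscalar_prod_smult_mat)

lemma positive_op_zero: "positive_op n (0\<^sub>m n n)"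
proof -
  have "0\<^sub>m n n = complex_of_real 0 \<cdot>\<^sub>m 1\<^sub>m n" by (rule eq_matI) auto
  then show ?thesis using positive_op_smult[OF positive_op_one, of 0 n] by simp
qed

lemma positive_op_eigenbasis:
  assumes "positive_op n A" "hermitian_eigenbasis n A P Q l" "i < n"
  shows "l i \<ge> 0"
proof -
  interpret hermitian_eigenbasis n A P Q l by fact
  let ?v = "col P i"
  have v: "?v \<in> carrier_vec n" using P assms(3) by auto
  have "(A *\<^sub>v ?v) \<bullet>c ?v = complex_of_real (l i) * (?v \<bullet>c ?v)"
    using eigenvector_col[OF assms(3), of "\<lambda>x. x"] v by (simp add: F_id)
  then have "Re ((A *\<^sub>v ?v) \<bullet>c ?v) = l i * Re (?v \<bullet>c ?v)" by simp
  moreover have "Re ((A *\<^sub>v ?v) \<bullet>c ?v) \<ge> 0" using assms(1) v by (simp add: positive_op_def)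
  ultimately show ?thesis
    using cscalar_prod_self_pos[OF v col_nonzero[OF assms(3)]] by (simp add: zero_le_mult_iff)
qed

text \<open>The root is \<open>F sqrt\<close>, which squares to \<open>A\<close> because the
  eigenvalues are nonnegative. The last clause later carries commutation with an effect over to its
  Kraus operator.\<close>

lemma positive_op_sqrt:
  assumes "positive_op n A"
  obtains S where "S \<in> carrier_mat n n" "mat_adjoint S = S" "S * S = A"
    "\<And>B. B \<in> carrier_mat n n \<Longrightarrow> B * A = A * B \<Longrightarrow> B * S = S * B"
proof -
  obtain P Q l where eb: "hermitian_eigenbasis n A P Q l"
    using hermitian_eigenbasis_exists positive_op_carrier[OF assms] positive_op_adjoint[OF assms] by blast
  interpret hermitian_eigenbasis n A P Q l by fact
  have "F (\<lambda>x. sqrt x * sqrt x) = F (\<lambda>x. x)"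
    by (rule F_cong) (use positive_op_eigenbasis[OF assms eb] in auto)
  then have "F sqrt * F sqrt = A" by (simp add: F_mult F_id)
  then show thesis using that[of "F sqrt"] F_adjoint F_commute by auto
qed

text \<open>With \<open>S\<close> the square root of \<open>A\<close>, the quadratic form at
  \<open>v\<close> is the squared length of \<open>S *\<^sub>v v\<close>, and
  \<open>A *\<^sub>v v\<close> is the image of that vector under \<open>S\<close>.\<close>

lemma positive_op_kernel:
  assumes A: "positive_op n A" and v: "v \<in> carrier_vec n" and z: "Re ((A *\<^sub>v v) \<bullet>c v) = 0"
  shows "A *\<^sub>v v = 0\<^sub>v n"
proof -
  obtain S where S: "S \<in> carrier_mat n n" "mat_adjoint S = S" "S * S = A"
    using positive_op_sqrt[OF A] by metis
  have Sv: "S *\<^sub>v v \<in> carrier_vec n" using S v by auto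
  have Av: "A *\<^sub>v v = S *\<^sub>v (S *\<^sub>v v)" using S v by (metis assoc_mult_mat_vec)
  have "(A *\<^sub>v v) \<bullet>c v = (S *\<^sub>v v) \<bullet>c (S *\<^sub>v v)"
    using cscalar_prod_mult_mat_vec[OF S(1) Sv v] S by (simp add: Av)
  then have "S *\<^sub>v v = 0\<^sub>v n" using cscalar_prod_self_pos[OF Sv] z by fastforce
  then show ?thesis using Av S by auto
qed

lemma posdef_op_if_injective:
  assumes A: "positive_op n A" and inj: "\<And>v. v \<in> carrier_vec n \<Longrightarrow> A *\<^sub>v v = 0\<^sub>v n \<Longrightarrow> v = 0\<^sub>v n"
  shows "posdef_op n A"
proof -
  have "Re ((A *\<^sub>v v) \<bullet>c v) > 0" if "v \<in> carrier_vec n" "v \<noteq> 0\<^sub>v n" for v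
  proof -
    have "Re ((A *\<^sub>v v) \<bullet>c v) \<noteq> 0" using positive_op_kernel[OF A] inj that by blast
    moreover have "Re ((A *\<^sub>v v) \<bullet>c v) \<ge> 0" using A that by (simp add: positive_op_def)
    ultimately show ?thesis by linarith
  qed
  then show ?thesis using A by (simp add: positive_op_def posdef_op_def)
qed

text \<open>This is the squared Hilbert-Schmidt norm of \<open>C\<close>.\<close>

lemma mtrace_square_sum:
  assumes C: "C \<in> carrier_mat n m"
  shows "mtrace (mat_adjoint C * C) = complex_of_real (\<Sum>i<m. \<Sum>k<n. (cmod (C $$ (k,i)))\<^sup>2)"
  using C by (simp add: mtrace_mult_sum[of _ m n] complex_norm_square mult.commute del: of_real_power)

lemma mtrace_square_eq_0:
  assumes C: "C \<in> carrier_mat n m" and z: "Re (mtrace (mat_adjoint C * C)) = 0"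
  shows "C = 0\<^sub>m n m"
proof (rule eq_matI)
  have s: "(\<Sum>i<m. \<Sum>k<n. (cmod (C $$ (k,i)))\<^sup>2) = 0"
    using z by (simp only: mtrace_square_sum[OF C] Re_complex_of_real)
  fix k i assume ki: "k < dim_row (0\<^sub>m n m)" "i < dim_col (0\<^sub>m n m)"
  have "(\<Sum>k<n. (cmod (C $$ (k,i)))\<^sup>2) = 0"
    using s ki by (subst (asm) sum_nonneg_eq_0_iff) (auto intro: sum_nonneg)
  then show "C $$ (k,i) = 0\<^sub>m n m $$ (k,i)"
    using ki by (subst (asm) sum_nonneg_eq_0_iff) auto
qed (use C in auto)

lemma mtrace_square_nonneg:
  assumes C: "C \<in> carrier_mat n m"
  shows "Re (mtrace (mat_adjoint C * C)) \<ge> 0"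
  by (simp only: mtrace_square_sum[OF C] Re_complex_of_real) (auto intro!: sum_nonneg)

text \<open>With \<open>S\<close> and \<open>T\<close> the roots of \<open>A\<close> and
  \<open>B\<close>, cyclicity turns the trace into the squared Hilbert-Schmidt norm of
  \<open>C = T * S\<close>. The product \<open>B * A = T * (T * S) * S\<close> vanishes together
  with \<open>C\<close>.\<close>

lemma mtrace_positive_mult:
  assumes A: "positive_op n A" and B: "positive_op n B"
  obtains C where "C \<in> carrier_mat n n" "mtrace (A * B) = mtrace (mat_adjoint C * C)"
    "C = 0\<^sub>m n n \<Longrightarrow> B * A = 0\<^sub>m n n"
proof -
  obtain S where S: "S \<in> carrier_mat n n" "mat_adjoint S = S" "S * S = A"
    using positive_op_sqrt[OF A] by metis
  obtain T where T: "T \<in> carrier_mat n n" "mat_adjoint T = T" "T * T = B"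
    using positive_op_sqrt[OF B] by metis
  have "mtrace (A * B) = mtrace (S * (S * (T * T)))"
    using S T by (simp add: assoc_mult_mat_dim flip: S(3) T(3))
  also have "\<dots> = mtrace ((S * (T * T)) * S)"
    using S(1) T(1) by (intro mtrace_mult_commute[of _ n n]) (auto intro!: mult_carrier_mat[of _ n n])
  also have "\<dots> = mtrace (mat_adjoint (T * S) * (T * S))"
    using S(1,2) T(1,2) by (simp add: mat_adjoint_mult assoc_mult_mat_dim)
  finally have tr: "mtrace (A * B) = mtrace (mat_adjoint (T * S) * (T * S))" .
  have "B * A = T * ((T * S) * S)"
    using S T by (simp add: assoc_mult_mat_dim flip: S(3) T(3))
  then have "T * S = 0\<^sub>m n n \<Longrightarrow> B * A = 0\<^sub>m n n" using S T by simp
  then show thesis using that[of "T * S"] tr S T by auto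
qed

lemma mtrace_positive_mult_nonneg:
  assumes "positive_op n A" "positive_op n B"
  shows "Re (mtrace (A * B)) \<ge> 0"
  using mtrace_positive_mult[OF assms] mtrace_square_nonneg by metis

lemma mtrace_positive_mult_eq_0:
  assumes "positive_op n A" "positive_op n B" "Re (mtrace (A * B)) = 0"
  shows "B * A = 0\<^sub>m n n"
  using mtrace_positive_mult[OF assms(1,2)] mtrace_square_eq_0 assms(3) by metis

text \<open>A zero trace would give \<open>B * A = 0\<close>, placing every column of
  \<open>A\<close> in the trivial kernel of \<open>B\<close>. This is the sense in which a full-rank
  output detects every nonzero effect.\<close>

lemma mtrace_positive_posdef_pos:
  assumes A: "positive_op n A" and nz: "A \<noteq> 0\<^sub>m n n" and B: "posdef_op n B"
  shows "Re (mtrace (A * B)) > 0"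
proof -
  have Ac: "A \<in> carrier_mat n n" using A by (rule positive_op_carrier)
  have Bc: "B \<in> carrier_mat n n" using B by (simp add: posdef_op_def)
  have "Re (mtrace (A * B)) \<noteq> 0"
  proof
    assume "Re (mtrace (A * B)) = 0"
    then have BA: "B * A = 0\<^sub>m n n"
      using mtrace_positive_mult_eq_0[OF A posdef_op_positive[OF B]] by simp
    have "A = 0\<^sub>m n n"
    proof (rule mat_col_eqI)
      fix j assume "j < dim_col (0\<^sub>m n n :: complex mat)"
      then have j: "j < n" by simp
      then have "B *\<^sub>v col A j = 0\<^sub>v n"
        using Ac Bc col_mult2[OF Bc Ac j] by (simp add: BA)
      moreover have "col A j \<in> carrier_vec n" using Ac j by auto
      ultimately have "col A j = 0\<^sub>v n"
        using B unfolding posdef_op_def by force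
      then show "col A j = col (0\<^sub>m n n) j" using j by simp
    qed (use Ac in auto)
    then show False using nz by simp
  qed
  then show ?thesis using mtrace_positive_mult_nonneg[OF A posdef_op_positive[OF B]] by linarith
qed

subsection \<open>Finite sums of matrices\<close>

lemma msum_carrier [simp]: "msum n f X \<in> carrier_mat n n"
  by (simp add: msum_def)

lemma msum_dim [simp]: "dim_row (msum n f X) = n" "dim_col (msum n f X) = n"
  by (simp_all add: msum_def)

lemma msum_index [simp]: "i < n \<Longrightarrow> j < n \<Longrightarrow> msum n f X $$ (i,j) = (\<Sum>x\<in>X. f x $$ (i,j))"
  by (simp add: msum_def)

lemma msum_cong: "(\<And>x. x \<in> X \<Longrightarrow> f x = g x) \<Longrightarrow> msum n f X = msum n g X"
  by (simp add: msum_def cong: sum.cong)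

lemma msum_empty: "msum n f {} = 0\<^sub>m n n"
  by (rule eq_matI) auto

lemma msum_insert:
  "finite X \<Longrightarrow> x \<notin> X \<Longrightarrow> f x \<in> carrier_mat n n \<Longrightarrow> msum n f (insert x X) = f x + msum n f X"
  by (rule eq_matI) auto

lemma mult_msum:
  assumes "finite X" "C \<in> carrier_mat n n" "\<And>x. x \<in> X \<Longrightarrow> f x \<in> carrier_mat n n"
  shows "C * msum n f X = msum n (\<lambda>x. C * f x) X"
  using assms
proof (induction X rule: finite_induct)
  case (insert x X)
  have "C * msum n f (insert x X) = C * (f x + msum n f X)" using insert by (simp add: msum_insert)
  also have "\<dots> = C * f x + C * msum n f X"
    using insert by (intro mult_add_distrib_mat[of _ n n]) auto
  also have "\<dots> = msum n (\<lambda>x. C * f x) (insert x X)"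
    using insert by (subst msum_insert) (auto intro!: mult_carrier_mat[of _ n n])
  finally show ?case .
qed (simp add: msum_empty)

lemma msum_mult:
  assumes "finite X" "C \<in> carrier_mat n n" "\<And>x. x \<in> X \<Longrightarrow> f x \<in> carrier_mat n n"
  shows "msum n f X * C = msum n (\<lambda>x. f x * C) X"
  using assms
proof (induction X rule: finite_induct)
  case (insert x X)
  have "msum n f (insert x X) * C = (f x + msum n f X) * C" using insert by (simp add: msum_insert)
  also have "\<dots> = f x * C + msum n f X * C"
    using insert by (intro add_mult_distrib_mat[of _ n n]) auto
  also have "\<dots> = msum n (\<lambda>x. f x * C) (insert x X)"
    using insert by (subst msum_insert) (auto intro!: mult_carrier_mat[of _ n n])
  finally show ?case .
qed (simp add: msum_empty)

lemma mtrace_msum: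
  assumes "\<And>x. x \<in> X \<Longrightarrow> f x \<in> carrier_mat n n"
  shows "mtrace (msum n f X) = (\<Sum>x\<in>X. mtrace (f x))"
proof -
  have "mtrace (msum n f X) = (\<Sum>i<n. \<Sum>x\<in>X. f x $$ (i,i))" by (simp add: mtrace_def)
  also have "\<dots> = (\<Sum>x\<in>X. \<Sum>i<n. f x $$ (i,i))" by (rule sum.swap)
  also have "\<dots> = (\<Sum>x\<in>X. mtrace (f x))" using assms by (intro sum.cong refl) (simp add: mtrace_carrier[of _ n])
  finally show ?thesis .
qed

lemma cscalar_prod_msum:
  assumes "finite X" "v \<in> carrier_vec n" "\<And>x. x \<in> X \<Longrightarrow> f x \<in> carrier_mat n n"
  shows "(msum n f X *\<^sub>v v) \<bullet>c v = (\<Sum>x\<in>X. (f x *\<^sub>v v) \<bullet>c v)"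
  using assms
proof (induction X rule: finite_induct)
  case empty
  have "0\<^sub>m n n *\<^sub>v v = 0\<^sub>v n" using empty by (intro eq_vecI) auto
  then show ?case using empty by (simp add: msum_empty)
next
  case (insert x X)
  then show ?case by (simp add: msum_insert cscalar_prod_add_mat[of _ n])
qed

lemma positive_op_msum:
  assumes "finite X" "\<And>x. x \<in> X \<Longrightarrow> positive_op n (f x)"
  shows "positive_op n (msum n f X)"
  using assms by (induction X rule: finite_induct)
    (auto simp: msum_empty positive_op_zero msum_insert positive_op_carrier intro: positive_op_add)

subsection \<open>Kronecker products\<close>

text \<open>Splits a composite index into system part \<open>i\<close> and ancilla part
  \<open>s\<close>. Every tensor computation below rests on this.\<close>

lemma sum_prod_index: "(\<Sum>r<n*m. f r) = (\<Sum>i<n. \<Sum>s<m. f (i*m+s))" for f :: "nat \<Rightarrow> 'a :: comm_monoid_add"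
proof -
  have "(\<Sum>i<n. \<Sum>s<m. f (i*m+s)) = (\<Sum>i<n. sum f {i*m..<i*m+m})"
  proof (rule sum.cong[OF refl])
    fix i
    show "(\<Sum>s<m. f (i*m+s)) = sum f {i*m..<i*m+m}"
      using sum.shift_bounds_nat_ivl[of f 0 "i*m" m] by (simp add: lessThan_atLeast0 add.commute)
  qed
  also have "\<dots> = sum f {..<n*m}" by (rule sum.nat_group)
  finally show ?thesis by simp
qed

lemma prod_index_less: "i < n \<Longrightarrow> k < m \<Longrightarrow> i * m + k < n * (m :: nat)"
proof -
  assume a: "i < n" "k < m"
  then have "i * m + k < Suc i * m" by simp
  also have "\<dots> \<le> n * m" using a by (intro mult_le_mono) auto
  finally show ?thesis .
qed

lemma prod_index_div_mod:
  assumes "p < n * (m :: nat)"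
  shows "p div m < n" "p mod m < m"
proof -
  have "m > 0" using assms by (cases m) auto
  then show "p mod m < m" by simp
  show "p div m < n" using assms by (simp add: less_mult_imp_div_less)
qed

lemma kron_dim [simp]:
  "dim_row (kron A B) = dim_row A * dim_row B" "dim_col (kron A B) = dim_col A * dim_col B"
  by (simp_all add: kron_def)

lemma kron_carrier: "A \<in> carrier_mat a b \<Longrightarrow> B \<in> carrier_mat c d \<Longrightarrow> kron A B \<in> carrier_mat (a*c) (b*d)"
  by (rule carrier_matI) auto

lemma kron_index [simp]:
  "i < dim_row A * dim_row B \<Longrightarrow> j < dim_col A * dim_col B \<Longrightarrow>
   kron A B $$ (i,j) = A $$ (i div dim_row B, j div dim_col B) * B $$ (i mod dim_row B, j mod dim_col B)"
  by (simp add: kron_def)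

lemma kron_mult:
  assumes "dim_col A = dim_row C" "dim_col B = dim_row D"
  shows "kron A B * kron C D = kron (A * C) (B * D)"
proof (rule eq_matI)
  fix i j assume "i < dim_row (kron (A * C) (B * D))" "j < dim_col (kron (A * C) (B * D))"
  then have i: "i < dim_row A * dim_row B" and j: "j < dim_col C * dim_col D" by auto
  note ij = prod_index_div_mod[OF i] prod_index_div_mod[OF j]
  have "(kron A B * kron C D) $$ (i,j) = (\<Sum>k<dim_row C. \<Sum>s<dim_row D.
      kron A B $$ (i, k * dim_row D + s) * kron C D $$ (k * dim_row D + s, j))"
    using i j assms by (simp add: mult_mat_index_sum sum_prod_index del: index_mult_mat(1) kron_index)
  also have "\<dots> = (\<Sum>k<dim_row C. \<Sum>s<dim_row D.
      (A $$ (i div dim_row B, k) * C $$ (k, j div dim_col D)) * (B $$ (i mod dim_row B, s) * D $$ (s, j mod dim_col D)))"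
    using i j assms by (intro sum.cong refl) (simp add: prod_index_less)
  also have "\<dots> = kron (A * C) (B * D) $$ (i,j)"
    using i j ij assms
    by (simp add: mult_mat_index_sum sum_product del: index_mult_mat(1))
  finally show "(kron A B * kron C D) $$ (i,j) = kron (A * C) (B * D) $$ (i,j)" .
qed auto

lemma kron_adjoint: "mat_adjoint (kron A B) = kron (mat_adjoint A) (mat_adjoint B)"
  by (rule eq_matI) (auto simp: prod_index_div_mod)

lemma kron_one: "kron (1\<^sub>m n) (1\<^sub>m m) = 1\<^sub>m (n*m)"
proof (rule eq_matI)
  fix i j assume "i < dim_row (1\<^sub>m (n*m) :: complex mat)" "j < dim_col (1\<^sub>m (n*m) :: complex mat)"
  then have i: "i < n*m" and j: "j < n*m" by auto
  have "i div m = j div m \<Longrightarrow> i mod m = j mod m \<Longrightarrow> i = j" by (metis div_mult_mod_eq)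
  then show "kron (1\<^sub>m n) (1\<^sub>m m) $$ (i,j) = 1\<^sub>m (n*m) $$ (i,j)"
    using prod_index_div_mod[OF i] prod_index_div_mod[OF j] i j by auto
qed auto

lemma kron_add_left:
  "A \<in> carrier_mat n n \<Longrightarrow> B \<in> carrier_mat n n \<Longrightarrow> C \<in> carrier_mat m m \<Longrightarrow>
   kron (A + B) C = kron A C + kron B C"
  by (rule eq_matI) (auto simp: prod_index_div_mod distrib_right)

lemma kron_minus_left:
  "A \<in> carrier_mat n n \<Longrightarrow> B \<in> carrier_mat n n \<Longrightarrow> C \<in> carrier_mat m m \<Longrightarrow>
   kron (A - B) C = kron A C - kron B C"
  by (rule eq_matI) (auto simp: prod_index_div_mod left_diff_distrib)

lemma kron_minus_right:
  "A \<in> carrier_mat n n \<Longrightarrow> B \<in> carrier_mat m m \<Longrightarrow> C \<in> carrier_mat m m \<Longrightarrow>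
   kron A (B - C) = kron A B - kron A C"
  by (rule eq_matI) (auto simp: prod_index_div_mod right_diff_distrib)

lemma kron_msum_right:
  assumes "A \<in> carrier_mat n n" "\<And>x. x \<in> X \<Longrightarrow> Z x \<in> carrier_mat m m"
  shows "kron A (msum m Z X) = msum (n*m) (\<lambda>x. kron A (Z x)) X"
proof (rule eq_matI)
  fix i j assume "i < dim_row (msum (n*m) (\<lambda>x. kron A (Z x)) X)" "j < dim_col (msum (n*m) (\<lambda>x. kron A (Z x)) X)"
  then have i: "i < n*m" and j: "j < n*m" by auto
  have "kron A (Z x) $$ (i,j) = A $$ (i div m, j div m) * Z x $$ (i mod m, j mod m)" if "x \<in> X" for x
    using assms(1) assms(2)[OF that] i j by simp
  then show "kron A (msum m Z X) $$ (i,j) = msum (n*m) (\<lambda>x. kron A (Z x)) X $$ (i,j)"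
    using assms(1) i j by (simp add: prod_index_div_mod sum_distrib_left)
qed (use assms in auto)

text \<open>The Kronecker product of the two square roots is Hermitian and squares to
  \<open>kron A B\<close>.\<close>

lemma positive_op_kron:
  assumes "positive_op n A" "positive_op m B"
  shows "positive_op (n*m) (kron A B)"
proof -
  obtain S where S: "S \<in> carrier_mat n n" "mat_adjoint S = S" "S * S = A"
    using positive_op_sqrt[OF assms(1)] by metis
  obtain T where T: "T \<in> carrier_mat m m" "mat_adjoint T = T" "T * T = B"
    using positive_op_sqrt[OF assms(2)] by metis
  have "kron S T * kron S T = kron A B" using S T by (simp add: kron_mult)
  then show ?thesis
    using positive_op_square[OF kron_carrier[OF S(1) T(1)]] S T by (simp add: kron_adjoint)
qed

lemma kron_nonzero:
  assumes A: "A \<in> carrier_mat n n" "A \<noteq> 0\<^sub>m n n" and B: "B \<in> carrier_mat m m" "B \<noteq> 0\<^sub>m m m"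
  shows "kron A B \<noteq> 0\<^sub>m (n*m) (n*m)"
proof -
  obtain i j where ij: "i < n" "j < n" "A $$ (i,j) \<noteq> 0" using A by (metis eq_matI carrier_matD index_zero_mat)
  obtain k l where kl: "k < m" "l < m" "B $$ (k,l) \<noteq> 0" using B by (metis eq_matI carrier_matD index_zero_mat)
  have "kron A B $$ (i*m+k, j*m+l) \<noteq> 0" using A B ij kl by (simp add: prod_index_less)
  then show ?thesis using ij kl by (metis prod_index_less index_zero_mat(1))
qed

text \<open>The operator acts as \<open>B\<close> on each of the \<open>n\<close> blocks of a
  vector, so each block of a kernel vector lies in the trivial kernel of \<open>B\<close>.\<close>

lemma posdef_op_one_kron:
  assumes B: "posdef_op m B"
  shows "posdef_op (n*m) (kron (1\<^sub>m n) B)"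
proof -
  have Bc: "B \<in> carrier_mat m m" using B by (simp add: posdef_op_def)
  show ?thesis
  proof (rule posdef_op_if_injective)
    show "positive_op (n*m) (kron (1\<^sub>m n) B)"
      using positive_op_kron positive_op_one posdef_op_positive[OF B] by blast
    fix v assume v: "v \<in> carrier_vec (n*m)" and z: "kron (1\<^sub>m n) B *\<^sub>v v = 0\<^sub>v (n*m)"
    have row: "vec m (\<lambda>s. v $ (i*m+s)) = 0\<^sub>v m" if i: "i < n" for i
    proof -
      let ?w = "vec m (\<lambda>s. v $ (i*m+s))"
      have "(B *\<^sub>v ?w) $ k = 0" if k: "k < m" for k
      proof -
        have "(B *\<^sub>v ?w) $ k = (\<Sum>s<m. B $$ (k,s) * v $ (i*m+s))"
          using Bc k by (simp add: mult_mat_vec_index_sum del: index_mult_mat_vec)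
        \<comment> \<open>The sum over \<open>j\<close> is inserted artificially; its selector
          \<open>j = i\<close> is the entry of the identity factor.\<close>
        also have "\<dots> = (\<Sum>j<n. if j = i then (\<Sum>s<m. B $$ (k,s) * v $ (j*m+s)) else 0)"
          using i by simp
        also have "\<dots> = (\<Sum>j<n. \<Sum>s<m. kron (1\<^sub>m n) B $$ (i*m+k,j*m+s) * v $ (j*m+s))"
          using Bc i k by (intro sum.cong refl) (auto simp: prod_index_less)
        also have "\<dots> = (kron (1\<^sub>m n) B *\<^sub>v v) $ (i*m+k)"
          using Bc v i k
          by (simp add: mult_mat_vec_index_sum sum_prod_index prod_index_less del: index_mult_mat_vec kron_index)
        also have "\<dots> = 0" using prod_index_less[OF i k] by (simp add: z)
        finally show ?thesis .
      qed
      then have "B *\<^sub>v ?w = 0\<^sub>v m" using Bc by (intro eq_vecI) auto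
      then show ?thesis using B unfolding posdef_op_def by force
    qed
    show "v = 0\<^sub>v (n*m)"
    proof (rule eq_vecI)
      fix p assume "p < dim_vec (0\<^sub>v (n*m) :: complex vec)"
      then have p: "p < n*m" by simp
      have "vec m (\<lambda>s. v $ (p div m * m + s)) $ (p mod m) = 0"
        using row[of "p div m"] prod_index_div_mod[OF p] by simp
      then show "v $ p = 0\<^sub>v (n*m) $ p" using prod_index_div_mod[OF p] p by simp
    qed (use v in auto)
  qed
qed

subsection \<open>Partial traces\<close>

lemma ptrace2_carrier [simp]: "ptrace2 n m M \<in> carrier_mat n n"
  by (simp add: ptrace2_def)

lemma mtrace_ptrace2: "M \<in> carrier_mat (n*m) (n*m) \<Longrightarrow> mtrace (ptrace2 n m M) = mtrace M"
  by (simp add: mtrace_def ptrace2_def sum_prod_index)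

text \<open>The duality that characterizes the partial trace: an observable of the system alone sees
  only the reduced operator.\<close>

lemma mtrace_kron_one_mult:
  assumes P: "P \<in> carrier_mat n n" and M: "M \<in> carrier_mat (n*m) (n*m)"
  shows "mtrace (kron P (1\<^sub>m m) * M) = mtrace (P * ptrace2 n m M)"
proof -
  have "mtrace (kron P (1\<^sub>m m) * M) = (\<Sum>i<n. \<Sum>s<m. \<Sum>j<n. \<Sum>t<m.
      kron P (1\<^sub>m m) $$ (i*m+s, j*m+t) * M $$ (j*m+t, i*m+s))"
    using mtrace_mult_sum[OF kron_carrier[OF P one_carrier_mat] M]
    by (simp add: sum_prod_index)
  also have "\<dots> = (\<Sum>i<n. \<Sum>s<m. \<Sum>j<n. \<Sum>t<m. if t = s then P $$ (i,j) * M $$ (j*m+t, i*m+s) else 0)"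
    using P by (intro sum.cong refl) (auto simp: prod_index_less)
  also have "\<dots> = (\<Sum>i<n. \<Sum>s<m. \<Sum>j<n. P $$ (i,j) * M $$ (j*m+s, i*m+s))"
    by (intro sum.cong refl) simp
  also have "\<dots> = (\<Sum>i<n. \<Sum>j<n. \<Sum>s<m. P $$ (i,j) * M $$ (j*m+s, i*m+s))"
    by (rule sum.cong[OF refl], rule sum.swap)
  also have "\<dots> = mtrace (P * ptrace2 n m M)"
    using P by (simp add: mtrace_mult_sum[of _ n n]) (simp add: ptrace2_def sum_distrib_left)
  finally show ?thesis .
qed

lemma ptrace2_kron:
  assumes "A \<in> carrier_mat n n" "B \<in> carrier_mat m m"
  shows "ptrace2 n m (kron A B) = mtrace B \<cdot>\<^sub>m A"
proof (rule eq_matI)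
  fix i j assume "i < dim_row (mtrace B \<cdot>\<^sub>m A)" "j < dim_col (mtrace B \<cdot>\<^sub>m A)"
  then have ij: "i < n" "j < n" using assms by auto
  have "kron A B $$ (i*m+k, j*m+k) = A $$ (i,j) * B $$ (k,k)" if "k < m" for k
    using assms ij that by (simp add: prod_index_less)
  then show "ptrace2 n m (kron A B) $$ (i,j) = (mtrace B \<cdot>\<^sub>m A) $$ (i,j)"
    using assms ij by (simp add: ptrace2_def mtrace_def sum_distrib_left mult.commute)
qed (use assms in \<open>auto simp: ptrace2_def\<close>)

lemma ptrace2_msum:
  "ptrace2 n m (msum (n*m) f X) = msum n (\<lambda>x. ptrace2 n m (f x)) X"
proof (rule eq_matI)
  fix i j assume "i < dim_row (msum n (\<lambda>x. ptrace2 n m (f x)) X)" "j < dim_col (msum n (\<lambda>x. ptrace2 n m (f x)) X)"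
  then have ij: "i < n" "j < n" by auto
  then have "ptrace2 n m (msum (n*m) f X) $$ (i,j) = (\<Sum>k<m. \<Sum>x\<in>X. f x $$ (i*m+k, j*m+k))"
    by (simp add: ptrace2_def prod_index_less)
  also have "\<dots> = (\<Sum>x\<in>X. \<Sum>k<m. f x $$ (i*m+k, j*m+k))" by (rule sum.swap)
  finally show "ptrace2 n m (msum (n*m) f X) $$ (i,j) = msum n (\<lambda>x. ptrace2 n m (f x)) X $$ (i,j)"
    using ij by (simp add: ptrace2_def)
qed (auto simp: ptrace2_def)

subsection \<open>Completely positive maps\<close>

text \<open>Ampliation by a one-dimensional space is the map itself.\<close>

lemma completely_positive_positive:
  assumes \<Phi>: "completely_positive n k \<Phi>" and X: "positive_op n X"
  shows "positive_op k (\<Phi> X)"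
proof -
  have Xc: "X \<in> carrier_mat n n" using X by (rule positive_op_carrier)
  have "mat n n (\<lambda>(i,j). X $$ (i,j)) = X" using Xc by (intro eq_matI) auto
  then have "ampliate n k 1 \<Phi> X = mat k k (\<lambda>(p,q). \<Phi> X $$ (p,q))"
    by (simp add: ampliate_def)
  also have "\<dots> = \<Phi> X"
    using \<Phi> Xc by (intro eq_matI) (auto simp: completely_positive_def linear_map_op_def)
  finally show ?thesis using \<Phi> X unfolding completely_positive_def by (metis mult.right_neutral)
qed

lemma mult_conj_index:
  assumes "K \<in> carrier_mat k n" "Y \<in> carrier_mat n n" "i < k" "j < k"
  shows "(K * Y * mat_adjoint K) $$ (i,j) = (\<Sum>c<n. (\<Sum>b<n. K $$ (i,b) * Y $$ (b,c)) * cnj (K $$ (j,c)))"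
  using assms by (simp add: mult_mat_index_sum del: index_mult_mat(1) assoc_mult_mat)

text \<open>Ampliating conjugation by \<open>K\<close> gives conjugation by \<open>kron K 1\<close>,
  and conjugations preserve positivity.\<close>

lemma completely_positive_conj:
  assumes K: "K \<in> carrier_mat k n"
  shows "completely_positive n k (\<lambda>\<rho>. K * \<rho> * mat_adjoint K)"
proof -
  have KA: "mat_adjoint K \<in> carrier_mat n k" using K by simp
  have lin: "linear_map_op n k (\<lambda>\<rho>. K * \<rho> * mat_adjoint K)"
    unfolding linear_map_op_def
  proof (intro conjI ballI allI)
    fix A B :: "complex mat" and c :: complex assume A: "A \<in> carrier_mat n n"
    have KAc: "K * A \<in> carrier_mat k n" using K A by auto
    show "K * A * mat_adjoint K \<in> carrier_mat k k" using KAc KA by (rule mult_carrier_mat)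
    show "K * (c \<cdot>\<^sub>m A) * mat_adjoint K = c \<cdot>\<^sub>m (K * A * mat_adjoint K)"
      by (simp only: mult_smult_distrib[OF K A] mult_smult_assoc_mat[OF KAc KA])
    assume B: "B \<in> carrier_mat n n"
    have KBc: "K * B \<in> carrier_mat k n" using K B by auto
    show "K * (A + B) * mat_adjoint K = K * A * mat_adjoint K + K * B * mat_adjoint K"
      by (simp only: mult_add_distrib_mat[OF K A B] add_mult_distrib_mat[OF KAc KBc KA])
  qed
  have "positive_op (k*m) (ampliate n k m (\<lambda>\<rho>. K * \<rho> * mat_adjoint K) X)"
    if X: "positive_op (n*m) X" for m X
  proof -
    let ?K = "kron K (1\<^sub>m m)"
    have Xc: "X \<in> carrier_mat (n*m) (n*m)" using X by (rule positive_op_carrier)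
    have Kc: "?K \<in> carrier_mat (k*m) (n*m)" using kron_carrier[OF K one_carrier_mat] .
    have "ampliate n k m (\<lambda>\<rho>. K * \<rho> * mat_adjoint K) X = ?K * X * mat_adjoint ?K"
    proof (rule eq_matI)
      fix p q assume "p < dim_row (?K * X * mat_adjoint ?K)" "q < dim_col (?K * X * mat_adjoint ?K)"
      then have p: "p < k*m" and q: "q < k*m" using K by auto
      note pq = prod_index_div_mod[OF p] prod_index_div_mod[OF q]
      let ?Y = "mat n n (\<lambda>(i,j). X $$ (i*m + p mod m, j*m + q mod m))"
      \<comment> \<open>The factor \<open>kron K 1\<close> preserves the ancilla index, so each sum
        over a composite index collapses to a sum over the system index.\<close>
      have Kp: "?K $$ (r, b*m+s) = (if s = r mod m then K $$ (r div m, b) else 0)"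
        if "b < n" "s < m" "r < k*m" for r b s
        using that K prod_index_div_mod[OF that(3)] by (auto simp: prod_index_less)
      have inner: "(\<Sum>b<n*m. ?K $$ (p,b) * X $$ (b,c)) = (\<Sum>b<n. K $$ (p div m, b) * X $$ (b*m + p mod m, c))" for c
      proof -
        have "(\<Sum>b<n*m. ?K $$ (p,b) * X $$ (b,c))
          = (\<Sum>b<n. \<Sum>s<m. if s = p mod m then K $$ (p div m, b) * X $$ (b*m+s, c) else 0)"
          unfolding sum_prod_index by (intro sum.cong refl) (simp add: Kp p)
        then show ?thesis using pq by simp
      qed
      have "(?K * X * mat_adjoint ?K) $$ (p,q)
        = (\<Sum>c<n*m. (\<Sum>b<n. K $$ (p div m, b) * X $$ (b*m + p mod m, c)) * cnj (?K $$ (q,c)))"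
        using mult_conj_index[OF Kc Xc p q] by (simp only: inner)
      also have "\<dots> = (\<Sum>c<n. \<Sum>t<m. if t = q mod m then
          (\<Sum>b<n. K $$ (p div m, b) * X $$ (b*m + p mod m, c*m+t)) * cnj (K $$ (q div m, c)) else 0)"
        unfolding sum_prod_index by (intro sum.cong refl) (simp add: Kp q)
      also have "\<dots> = (\<Sum>c<n. (\<Sum>b<n. K $$ (p div m, b) * ?Y $$ (b,c)) * cnj (K $$ (q div m, c)))"
        using pq by simp
      also have "\<dots> = (K * ?Y * mat_adjoint K) $$ (p div m, q div m)"
        using pq by (subst mult_conj_index[OF K]) auto
      finally show "ampliate n k m (\<lambda>\<rho>. K * \<rho> * mat_adjoint K) X $$ (p,q) = (?K * X * mat_adjoint ?K) $$ (p,q)"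
        using p q by (simp add: ampliate_def)
    qed (use K in \<open>auto simp: ampliate_def\<close>)
    then show ?thesis using positive_op_conj[OF X Kc] by simp
  qed
  then show ?thesis using lin by (simp add: completely_positive_def)
qed

lemma completely_positive_msum:
  assumes J: "finite J" and \<Phi>: "\<And>a. a \<in> J \<Longrightarrow> completely_positive n k (\<Phi> a)"
  shows "completely_positive n k (\<lambda>\<rho>. msum k (\<lambda>a. \<Phi> a \<rho>) J)"
proof -
  have lin: "linear_map_op n k (\<Phi> a)" if "a \<in> J" for a
    using \<Phi>[OF that] by (simp add: completely_positive_def)
  have c: "\<Phi> a A \<in> carrier_mat k k" if "a \<in> J" "A \<in> carrier_mat n n" for a A
    using lin[OF that(1)] that by (simp add: linear_map_op_def)
  have "linear_map_op n k (\<lambda>\<rho>. msum k (\<lambda>a. \<Phi> a \<rho>) J)"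
    unfolding linear_map_op_def
  proof (intro conjI ballI allI)
    fix A B :: "complex mat" and r :: complex assume A: "A \<in> carrier_mat n n"
    show "msum k (\<lambda>a. \<Phi> a A) J \<in> carrier_mat k k" by simp
    have "msum k (\<lambda>a. \<Phi> a (r \<cdot>\<^sub>m A)) J = msum k (\<lambda>a. r \<cdot>\<^sub>m \<Phi> a A) J"
      using lin A by (intro msum_cong) (auto simp: linear_map_op_def)
    also have "\<dots> = r \<cdot>\<^sub>m msum k (\<lambda>a. \<Phi> a A) J"
    proof (rule eq_matI)
      fix i j assume "i < dim_row (r \<cdot>\<^sub>m msum k (\<lambda>a. \<Phi> a A) J)" "j < dim_col (r \<cdot>\<^sub>m msum k (\<lambda>a. \<Phi> a A) J)"
      then have ij: "i < k" "j < k" by auto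
      have "(r \<cdot>\<^sub>m \<Phi> a A) $$ (i,j) = r * \<Phi> a A $$ (i,j)" if "a \<in> J" for a
        using c[OF that A] ij by simp
      then show "msum k (\<lambda>a. r \<cdot>\<^sub>m \<Phi> a A) J $$ (i,j) = (r \<cdot>\<^sub>m msum k (\<lambda>a. \<Phi> a A) J) $$ (i,j)"
        using ij by (simp add: sum_distrib_left)
    qed auto
    finally show "msum k (\<lambda>a. \<Phi> a (r \<cdot>\<^sub>m A)) J = r \<cdot>\<^sub>m msum k (\<lambda>a. \<Phi> a A) J" .
    assume B: "B \<in> carrier_mat n n"
    have "msum k (\<lambda>a. \<Phi> a (A + B)) J = msum k (\<lambda>a. \<Phi> a A + \<Phi> a B) J"
      using lin A B by (intro msum_cong) (auto simp: linear_map_op_def)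
    also have "\<dots> = msum k (\<lambda>a. \<Phi> a A) J + msum k (\<lambda>a. \<Phi> a B) J"
    proof (rule eq_matI)
      fix i j assume "i < dim_row (msum k (\<lambda>a. \<Phi> a A) J + msum k (\<lambda>a. \<Phi> a B) J)"
        "j < dim_col (msum k (\<lambda>a. \<Phi> a A) J + msum k (\<lambda>a. \<Phi> a B) J)"
      then have ij: "i < k" "j < k" by auto
      have "(\<Phi> a A + \<Phi> a B) $$ (i,j) = \<Phi> a A $$ (i,j) + \<Phi> a B $$ (i,j)" if "a \<in> J" for a
        using c[OF that A] c[OF that B] ij by simp
      then show "msum k (\<lambda>a. \<Phi> a A + \<Phi> a B) J $$ (i,j) = (msum k (\<lambda>a. \<Phi> a A) J + msum k (\<lambda>a. \<Phi> a B) J) $$ (i,j)"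
        using ij by (simp add: sum.distrib)
    qed auto
    finally show "msum k (\<lambda>a. \<Phi> a (A + B)) J = msum k (\<lambda>a. \<Phi> a A) J + msum k (\<lambda>a. \<Phi> a B) J" .
  qed
  moreover have "positive_op (k*m) (ampliate n k m (\<lambda>\<rho>. msum k (\<lambda>a. \<Phi> a \<rho>) J) X)"
    if "positive_op (n*m) X" for m X
  proof -
    have "ampliate n k m (\<lambda>\<rho>. msum k (\<lambda>a. \<Phi> a \<rho>) J) X = msum (k*m) (\<lambda>a. ampliate n k m (\<Phi> a) X) J"
      by (rule eq_matI) (auto simp: ampliate_def prod_index_div_mod)
    then show ?thesis
      using positive_op_msum[OF J] \<Phi> that by (simp add: completely_positive_def)
  qed
  ultimately show ?thesis by (simp add: completely_positive_def)
qed

section \<open>Trace inequalities and passage from states to positive operators\<close>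

lemma mtrace_mult_mono:
  assumes A: "A \<in> carrier_mat n n" and A': "A' \<in> carrier_mat n n"
    and "positive_op n (A' - A)" and B: "positive_op n B"
  shows "Re (mtrace (A * B)) \<le> Re (mtrace (A' * B))"
proof -
  have Bc: "B \<in> carrier_mat n n" using B by (rule positive_op_carrier)
  have "(A' - A) * B = A' * B - A * B" by (rule minus_mult_distrib_mat[OF A' A Bc])
  then have "mtrace ((A' - A) * B) = mtrace (A' * B) - mtrace (A * B)"
    using A A' Bc by (simp add: mtrace_minus[of _ n])
  then show ?thesis using mtrace_positive_mult_nonneg[OF assms(3,4)] by simp
qed

lemma mtrace_kron:
  assumes "A \<in> carrier_mat n n" "B \<in> carrier_mat m m"
  shows "mtrace (kron A B) = mtrace A * mtrace B"
  using mtrace_ptrace2[OF kron_carrier[OF assms]] assms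
  by (simp add: ptrace2_kron mtrace_smult[of _ n] mult.commute)

lemma positive_op_normalize:
  assumes B: "positive_op n B" and nz: "B \<noteq> 0\<^sub>m n n"
  obtains r where "r > 0" "is_state n (complex_of_real (1/r) \<cdot>\<^sub>m B)"
proof -
  have Bc: "B \<in> carrier_mat n n" using B by (rule positive_op_carrier)
  define r where "r = Re (mtrace B)"
  have r: "r > 0" using mtrace_positive_posdef_pos[OF B nz posdef_op_one] Bc by (simp add: r_def)
  \<comment> \<open>\<open>is_state\<close> requires the complex trace to equal 1, so the trace must
    be shown to be real before dividing by its real part.\<close>
  have "mtrace B = cnj (mtrace B)"
    using positive_op_adjoint[OF B] Bc by (metis (no_types, lifting) mtrace_def cnj_sum
        mat_adjoint_index carrier_matD conjugate_complex_def lessThan_iff sum.cong)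
  then have "mtrace B = complex_of_real r" by (simp add: r_def complex_eq_iff)
  then have "mtrace (complex_of_real (1/r) \<cdot>\<^sub>m B) = 1" using r Bc by (simp add: mtrace_smult[of _ n])
  then show thesis using that[OF r] positive_op_smult[OF B, of "1/r"] r by (simp add: is_state_def)
qed

lemma linear_map_op_smult: "linear_map_op n k \<Phi> \<Longrightarrow> A \<in> carrier_mat n n \<Longrightarrow> \<Phi> (c \<cdot>\<^sub>m A) = c \<cdot>\<^sub>m \<Phi> A"
  by (simp add: linear_map_op_def)

lemma linear_map_op_add: "linear_map_op n k \<Phi> \<Longrightarrow> A \<in> carrier_mat n n \<Longrightarrow> B \<in> carrier_mat n n \<Longrightarrow>
  \<Phi> (A + B) = \<Phi> A + \<Phi> B"
  by (simp add: linear_map_op_def)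

lemma linear_map_op_carrier: "linear_map_op n k \<Phi> \<Longrightarrow> A \<in> carrier_mat n n \<Longrightarrow> \<Phi> A \<in> carrier_mat k k"
  by (simp add: linear_map_op_def)

lemma completely_positive_linear: "completely_positive n k \<Phi> \<Longrightarrow> linear_map_op n k \<Phi>"
  by (simp add: completely_positive_def)

lemma mtrace_mult_smult:
  assumes "A \<in> carrier_mat n n" "B \<in> carrier_mat n n"
  shows "mtrace (A * (c \<cdot>\<^sub>m B)) = c * mtrace (A * B)"
  using assms by (simp add: mult_smult_distrib[of _ n n _ n] mtrace_smult[of _ n])

text \<open>Instruments and non-disturbance are specified on states only. Rescaling extends such
  identities to unnormalized inputs such as projections and the identity.\<close>

lemma mtrace_eq_if_states:
  assumes \<Phi>: "linear_map_op n n \<Phi>" and A: "A \<in> carrier_mat n n" and C: "C \<in> carrier_mat n n"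
    and eq: "\<And>\<rho>. is_state n \<rho> \<Longrightarrow> mtrace (A * \<Phi> \<rho>) = mtrace (C * \<rho>)"
    and B: "positive_op n B" "B \<noteq> 0\<^sub>m n n"
  shows "mtrace (A * \<Phi> B) = mtrace (C * B)"
proof -
  have Bc: "B \<in> carrier_mat n n" using B(1) by (rule positive_op_carrier)
  obtain r where r: "r > 0" "is_state n (complex_of_real (1/r) \<cdot>\<^sub>m B)"
    using positive_op_normalize[OF B] .
  have "complex_of_real (1/r) * mtrace (A * \<Phi> B) = complex_of_real (1/r) * mtrace (C * B)"
    using eq[OF r(2)] linear_map_op_carrier[OF \<Phi> Bc] A C Bc
    by (simp only: linear_map_op_smult[OF \<Phi> Bc] mtrace_mult_smult)
  then show ?thesis using r(1) by simp
qed

lemma total_channel_completely_positive: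
  assumes "finite X" "is_instrument d X E \<I>"
  shows "completely_positive d d (total_channel d X \<I>)"
proof -
  have "total_channel d X \<I> = (\<lambda>\<rho>. msum d (\<lambda>x. \<I> x \<rho>) X)" by (simp add: total_channel_def fun_eq_iff)
  then show ?thesis using completely_positive_msum[of X d d \<I>] assms by (simp add: is_instrument_def)
qed

section \<open>Orthogonal projections and their complements\<close>

lemma orth_projection_positive:
  assumes "orth_projection n P"
  shows "positive_op n P"
  using assms positive_op_square[of P n] by (simp add: orth_projection_def)

lemma orth_projection_mult_complement:
  assumes P: "orth_projection n P"
  shows "P * (1\<^sub>m n - P) = 0\<^sub>m n n"
proof -
  have Pc: "P \<in> carrier_mat n n" "P * P = P" using P by (auto simp: orth_projection_def)
  then show ?thesis using mult_minus_distrib_mat[OF Pc(1) one_carrier_mat Pc(1)] by simp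
qed

lemma orth_projection_complement:
  assumes P: "orth_projection n P"
  shows "orth_projection n (1\<^sub>m n - P)"
proof -
  have Pc: "P \<in> carrier_mat n n" "P * P = P" "mat_adjoint P = P" using P by (auto simp: orth_projection_def)
  have P': "1\<^sub>m n - P \<in> carrier_mat n n" using Pc by (auto intro: minus_carrier_mat)
  have "(1\<^sub>m n - P) * (1\<^sub>m n - P) = (1\<^sub>m n - P) - P * (1\<^sub>m n - P)"
    using minus_mult_distrib_mat[OF one_carrier_mat Pc(1) P'] left_mult_one_mat[OF P'] by simp
  also have "\<dots> = 1\<^sub>m n - P"
    unfolding orth_projection_mult_complement[OF P] using Pc(1) by (intro eq_matI) auto
  finally show ?thesis
    using Pc P' unfolding orth_projection_def by (auto simp: mat_adjoint_minus[of _ n n])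
qed

subsection \<open>Disturbance by norm-one effects\<close>

text \<open>The conclusion says that some of the complement of \<open>P\<close> leaks into
  \<open>P\<close>. In this form it refutes both the fixed-point equation for the dual and the
  non-disturbance condition on states.\<close>

lemma third_law_disturbs_projection:
  assumes d: "0 < d" and X: "finite X" "x \<in> X"
    and P: "orth_projection d P" "P \<noteq> 0\<^sub>m d d"
    and E: "positive_op d (E x)" "positive_op d (1\<^sub>m d - E x)" "E x \<noteq> 1\<^sub>m d" "E x * P = P"
    and inst: "is_instrument d X E \<I>"
    and impl: "third_law_scheme_implements d X m \<xi> \<E> Z \<I>"
  shows "mtrace (P * total_channel d X \<I> (1\<^sub>m d - P)) \<noteq> 0"
proof
  assume undisturbed: "mtrace (P * total_channel d X \<I> (1\<^sub>m d - P)) = 0"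
  define P' where "P' = 1\<^sub>m d - P"
  have Pp: "positive_op d P" and P'p: "positive_op d P'"
    using orth_projection_positive P orth_projection_complement unfolding P'_def by blast+
  then have Pc: "P \<in> carrier_mat d d" and P'c: "P' \<in> carrier_mat d d" by (auto dest: positive_op_carrier)
  have PP': "P + P' = 1\<^sub>m d" using Pc by (intro eq_matI) (auto simp: P'_def)
  have Ec: "E x \<in> carrier_mat d d" using E(1) by (rule positive_op_carrier)
  from impl have m: "0 < m" and \<xi>: "full_rank_state m \<xi>"
    and chan: "third_law_channel (d*m) (d*m) \<E>" and Z: "\<And>x. x \<in> X \<Longrightarrow> positive_op m (Z x)" "msum m Z X = 1\<^sub>m m"
    and I: "\<And>x \<rho>. x \<in> X \<Longrightarrow> \<rho> \<in> carrier_mat d d \<Longrightarrow> \<I> x \<rho> = ptrace2 d m (kron (1\<^sub>m d) (Z x) * \<E> (kron \<rho> \<xi>))"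
    by (auto simp: third_law_scheme_implements_def)
  have \<xi>p: "positive_op m \<xi>" "posdef_op m \<xi>" and \<xi>tr: "mtrace \<xi> = 1"
    using \<xi> by (auto simp: full_rank_state_def is_state_def)
  have \<xi>c: "\<xi> \<in> carrier_mat m m" using \<xi>p(1) by (rule positive_op_carrier)
  have cp: "completely_positive (d*m) (d*m) \<E>"
    and tp: "\<And>A. A \<in> carrier_mat (d*m) (d*m) \<Longrightarrow> mtrace (\<E> A) = mtrace A"
    using chan by (auto simp: third_law_channel_def is_channel_def)
  note lin = completely_positive_linear[OF cp]
  have Zc: "Z x \<in> carrier_mat m m" if "x \<in> X" for x using Z(1)[OF that] by (rule positive_op_carrier)
  define M where "M B = \<E> (kron B \<xi>)" for B
  have Mc: "M B \<in> carrier_mat (d*m) (d*m)" if "B \<in> carrier_mat d d" for B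
    using linear_map_op_carrier[OF lin kron_carrier[OF that \<xi>c]] by (simp add: M_def)
  have Mp: "positive_op (d*m) (M B)" if "positive_op d B" for B
    unfolding M_def by (rule completely_positive_positive[OF cp positive_op_kron[OF that \<xi>p(1)]])
  have M1: "M (1\<^sub>m d) = M P + M P'"
    unfolding M_def PP'[symmetric] kron_add_left[OF Pc P'c \<xi>c]
    using linear_map_op_add[OF lin kron_carrier[OF Pc \<xi>c] kron_carrier[OF P'c \<xi>c]] .
  have trM: "mtrace (M B) = mtrace B" if "B \<in> carrier_mat d d" for B
    using tp[OF kron_carrier[OF that \<xi>c]] mtrace_kron[OF that \<xi>c] by (simp add: M_def \<xi>tr)
  \<comment> \<open>Summing over outcomes replaces the pointer effects by the identity, so the total
    channel is the reduced output.\<close>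
  have total: "total_channel d X \<I> B = ptrace2 d m (M B)" if B: "B \<in> carrier_mat d d" for B
  proof -
    have "total_channel d X \<I> B = msum d (\<lambda>x. ptrace2 d m (kron (1\<^sub>m d) (Z x) * M B)) X"
      unfolding total_channel_def using I[OF _ B] by (intro msum_cong) (simp add: M_def)
    also have "\<dots> = ptrace2 d m (msum (d*m) (\<lambda>x. kron (1\<^sub>m d) (Z x) * M B) X)"
      by (simp add: ptrace2_msum)
    also have "msum (d*m) (\<lambda>x. kron (1\<^sub>m d) (Z x) * M B) X = kron (1\<^sub>m d) (msum m Z X) * M B"
      using Zc Mc[OF B] by (simp add: kron_msum_right[of _ d] msum_mult[OF X(1)] kron_carrier[OF one_carrier_mat])
    finally show ?thesis using Mc[OF B] by (simp add: Z(2) kron_one)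
  qed
  \<comment> \<open>The pointer effect for all outcomes other than \<open>x\<close>, positive as the
    sum of the remaining \<open>Z\<close>.\<close>
  define W where "W = 1\<^sub>m m - Z x"
  have "msum m Z X = Z x + msum m Z (X - {x})"
    using X Zc msum_insert[of "X - {x}" x Z m] by (simp add: insert_absorb)
  then have "W = msum m Z (X - {x})" using Zc[OF X(2)] Z(2) by (intro eq_matI) (auto simp: W_def)
  then have Wp: "positive_op m W" using positive_op_msum[of "X - {x}" m Z] X Z(1) by simp
  have Wc: "W \<in> carrier_mat m m" using Wp by (rule positive_op_carrier)
  \<comment> \<open>For a state \<open>B\<close> this is the probability of not obtaining
    \<open>x\<close>; the instrument condition expresses it by \<open>E x\<close>.\<close>
  have trW: "mtrace (kron (1\<^sub>m d) W * M B) = mtrace B - mtrace (E x * B)"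
    if B: "positive_op d B" "B \<noteq> 0\<^sub>m d d" for B
  proof -
    have Bc: "B \<in> carrier_mat d d" using B(1) by (rule positive_op_carrier)
    have ZM: "kron (1\<^sub>m d) (Z x) * M B \<in> carrier_mat (d*m) (d*m)"
      by (rule mult_carrier_mat[OF kron_carrier[OF one_carrier_mat Zc[OF X(2)]] Mc[OF Bc]])
    have lI: "linear_map_op d d (\<I> x)"
      using inst X(2) by (auto simp: is_instrument_def intro: completely_positive_linear)
    have Ic: "\<I> x \<rho> \<in> carrier_mat d d" if "is_state d \<rho>" for \<rho>
      using lI that by (auto simp: is_state_def intro: linear_map_op_carrier positive_op_carrier)
    have "mtrace (1\<^sub>m d * \<I> x B) = mtrace (E x * B)"
      by (rule mtrace_eq_if_states[OF lI one_carrier_mat Ec _ B])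
         (use inst X(2) in \<open>auto simp: is_instrument_def left_mult_one_mat[OF Ic]\<close>)
    then have "mtrace (\<I> x B) = mtrace (E x * B)"
      using linear_map_op_carrier[OF lI Bc] by simp
    then have "mtrace (kron (1\<^sub>m d) (Z x) * M B) = mtrace (E x * B)"
      using I[OF X(2) Bc] mtrace_ptrace2[OF ZM] by (simp add: M_def)
    moreover have "kron (1\<^sub>m d) W * M B = M B - kron (1\<^sub>m d) (Z x) * M B"
      unfolding W_def using Zc[OF X(2)] Mc[OF Bc] kron_carrier[OF one_carrier_mat Zc[OF X(2)], of d]
      by (simp add: kron_minus_right[of _ d _ m] kron_one minus_mult_distrib_mat[of _ "d*m" "d*m"])
    ultimately show ?thesis using mtrace_minus[OF Mc[OF Bc] ZM] trM[OF Bc] by simp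
  qed
  have one0: "1\<^sub>m d \<noteq> (0\<^sub>m d d :: complex mat)"
    using d by (metis index_one_mat(1) index_zero_mat(1) zero_neq_one)
  \<comment> \<open>If \<open>W\<close> vanished, outcome \<open>x\<close> would be certain on every
    input. Then the positive operator \<open>1 - E x\<close> would have trace zero and
    \<open>E x\<close> would be the identity.\<close>
  have W0: "W \<noteq> 0\<^sub>m m m"
  proof
    assume "W = 0\<^sub>m m m"
    then have "kron (1\<^sub>m d) W = 0\<^sub>m (d*m) (d*m)"
      by (intro eq_matI) (auto simp: prod_index_div_mod)
    then have "mtrace (kron (1\<^sub>m d) W * M (1\<^sub>m d)) = 0"
      using Mc[OF one_carrier_mat] by (simp add: mtrace_def)
    then have "mtrace (1\<^sub>m d - E x) = 0"
      using trW[OF positive_op_one one0] Ec by (simp add: mtrace_minus[of _ d])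
    moreover have "1\<^sub>m d - E x \<noteq> 0\<^sub>m d d"
    proof
      assume z: "1\<^sub>m d - E x = 0\<^sub>m d d"
      have "E x = 1\<^sub>m d - (1\<^sub>m d - E x)" using Ec by (intro eq_matI) auto
      then show False using E(3) unfolding z by auto
    qed
    ultimately show False
      using mtrace_positive_posdef_pos[OF E(2) _ posdef_op_one] right_mult_one_mat[OF positive_op_carrier[OF E(2)]] by simp
  qed
  define Q where "Q = kron P W"
  have Qc: "Q \<in> carrier_mat (d*m) (d*m)" using kron_carrier[OF Pc Wc] by (simp add: Q_def)
  have M1pos: "posdef_op (d*m) (M (1\<^sub>m d))"
  proof -
    \<comment> \<open>The third law concerns states, so \<open>kron 1 \<xi>\<close> is divided by
      its trace \<open>d\<close>, and the factor is restored afterwards.\<close>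
    let ?\<tau> = "complex_of_real (1/d) \<cdot>\<^sub>m kron (1\<^sub>m d) \<xi>"
    have k: "kron (1\<^sub>m d) \<xi> \<in> carrier_mat (d*m) (d*m)" using kron_carrier[OF one_carrier_mat \<xi>c] .
    have pd: "posdef_op (d*m) ?\<tau>"
      by (rule posdef_op_smult[OF posdef_op_one_kron[OF \<xi>p(2)]]) (use d in simp)
    have "mtrace (1\<^sub>m d) = of_nat d" by (simp add: mtrace_def)
    then have "mtrace ?\<tau> = 1"
      using d k \<xi>c by (simp add: mtrace_smult[of _ "d*m"] mtrace_kron[of _ d _ m] \<xi>tr)
    then have "full_rank_state (d*m) ?\<tau>"
      using pd posdef_op_positive[OF pd] by (simp add: full_rank_state_def is_state_def)
    then have "posdef_op (d*m) (\<E> ?\<tau>)"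
      using chan by (simp add: third_law_channel_def full_rank_state_def)
    then have "posdef_op (d*m) (complex_of_real (1/d) \<cdot>\<^sub>m M (1\<^sub>m d))"
      by (simp only: linear_map_op_smult[OF lin k] M_def)
    then have "posdef_op (d*m) (complex_of_real d \<cdot>\<^sub>m (complex_of_real (1/d) \<cdot>\<^sub>m M (1\<^sub>m d)))"
      by (rule posdef_op_smult) (use d in simp)
    also have "complex_of_real d \<cdot>\<^sub>m (complex_of_real (1/d) \<cdot>\<^sub>m M (1\<^sub>m d)) = M (1\<^sub>m d)"
      using d Mc[OF one_carrier_mat] by (intro eq_matI) auto
    finally show ?thesis .
  qed
  have "positive_op (d*m) Q" "Q \<noteq> 0\<^sub>m (d*m) (d*m)"
    unfolding Q_def using positive_op_kron[OF Pp Wp] kron_nonzero[OF Pc P(2) Wc W0] by auto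
  from mtrace_positive_posdef_pos[OF this M1pos]
  have "0 < Re (mtrace (Q * M (1\<^sub>m d)))" .
  also have "\<dots> = Re (mtrace (Q * M P)) + Re (mtrace (Q * M P'))"
    using mtrace_add[OF mult_carrier_mat[OF Qc Mc[OF Pc]] mult_carrier_mat[OF Qc Mc[OF P'c]]]
    by (simp add: M1 mult_add_distrib_mat[OF Qc Mc[OF Pc] Mc[OF P'c]])
  \<comment> \<open>Dropping the condition that the system is found in \<open>P\<close> enlarges the
    effect by \<open>kron P' W\<close>, which is positive.\<close>
  also have "Re (mtrace (Q * M P)) \<le> Re (mtrace (kron (1\<^sub>m d) W * M P))"
  proof (rule mtrace_mult_mono[OF Qc kron_carrier[OF one_carrier_mat Wc] _ Mp[OF Pp]])
    have "kron (1\<^sub>m d) W - Q = kron P' W"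
      unfolding Q_def P'_def using kron_minus_left[OF one_carrier_mat Pc Wc] by simp
    then show "positive_op (d*m) (kron (1\<^sub>m d) W - Q)" using positive_op_kron[OF P'p Wp] by simp
  qed
  also have "\<dots> = 0" using trW[OF Pp P(2)] E(4) by simp
  \<comment> \<open>Dropping the condition on the outcome enlarges the effect by
    \<open>kron P (Z x)\<close>, which is positive.\<close>
  also have "Re (mtrace (Q * M P')) \<le> Re (mtrace (kron P (1\<^sub>m m) * M P'))"
  proof (rule mtrace_mult_mono[OF Qc kron_carrier[OF Pc one_carrier_mat] _ Mp[OF P'p]])
    have "1\<^sub>m m - W = Z x" using Zc[OF X(2)] by (intro eq_matI) (auto simp: W_def)
    then have "kron P (1\<^sub>m m) - Q = kron P (Z x)"
      unfolding Q_def using kron_minus_right[OF Pc one_carrier_mat Wc] by simp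
    then show "positive_op (d*m) (kron P (1\<^sub>m m) - Q)" using positive_op_kron[OF Pp Z(1)[OF X(2)]] by simp
  qed
  also have "\<dots> = 0"
    using mtrace_kron_one_mult[OF Pc Mc[OF P'c]] total[OF P'c] undisturbed by (simp flip: P'_def)
  finally show False by simp
qed

section \<open>Effects of norm one and their eigenprojections\<close>

lemma Re_cscalar_prod_self: "Re (v \<bullet>c v) = (vnorm v)\<^sup>2" for v :: "complex vec"
  unfolding cscalar_prod_self Re_complex_of_real vnorm_def by (simp add: sum_nonneg)

text \<open>With \<open>c\<close> the largest eigenvalue, c^2 - A^2 is the square of the Hermitian
  matrix \<open>F ?g\<close>, hence positive, and this bounds the length of
  \<open>A *\<^sub>v v\<close> by \<open>c\<close>. Read contrapositively, norm one forces an
  eigenvalue that is at least 1.\<close>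

lemma op_norm_less_one:
  assumes n: "0 < n" and A: "positive_op n A" and eb: "hermitian_eigenbasis n A P Q l"
    and less: "\<And>i. i < n \<Longrightarrow> l i < 1"
  shows "op_norm n A < 1"
proof -
  interpret hermitian_eigenbasis n A P Q l by fact
  have Ac: "A \<in> carrier_mat n n" using A by (rule positive_op_carrier)
  \<comment> \<open>A uniform bound below 1 is required, since a supremum of numbers that are each
    below 1 could still equal 1.\<close>
  define c where "c = Max (l ` {..<n})"
  have c: "l i \<le> c" if "i < n" for i using that by (simp add: c_def)
  have c1: "c < 1" using n less unfolding c_def by (subst Max_less_iff) auto
  have l0: "0 \<le> l i" if "i < n" for i using positive_op_eigenbasis[OF A eb that] .
  have c0: "c \<ge> 0" using c[OF n] l0[OF n] by simp
  let ?g = "\<lambda>x. sqrt (c\<^sup>2 - x\<^sup>2)"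
  have "F (\<lambda>x. ?g x * ?g x) = F (\<lambda>x. c\<^sup>2 - x * x)"
  proof (rule F_cong)
    fix i assume "i < n"
    then have "(l i)\<^sup>2 \<le> c\<^sup>2" using c l0 by (intro power_mono) auto
    then show "?g (l i) * ?g (l i) = c\<^sup>2 - l i * l i" by (simp add: power2_eq_square)
  qed
  then have "positive_op n (F (\<lambda>x. c\<^sup>2 - x * x))"
    using positive_op_square[OF F_carrier F_adjoint, of ?g] by (simp add: F_mult)
  moreover have "F (\<lambda>x. c\<^sup>2) = F (\<lambda>x. c\<^sup>2 - x * x) + A * A"
    by (simp add: F_add F_mult flip: F_id)
  moreover have "F (\<lambda>x. c\<^sup>2) = complex_of_real (c\<^sup>2) \<cdot>\<^sub>m 1\<^sub>m n"
  proof -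
    have "D (\<lambda>x. c\<^sup>2) = complex_of_real (c\<^sup>2) \<cdot>\<^sub>m 1\<^sub>m n" by (rule eq_matI) (auto simp: mat_diag_def)
    then show ?thesis using P Q
      by (simp add: F_def mult_smult_distrib[of P n n _ n] mult_smult_assoc_mat[of _ n n _ n] PQ)
  qed
  ultimately have eq: "complex_of_real (c\<^sup>2) \<cdot>\<^sub>m 1\<^sub>m n = F (\<lambda>x. c\<^sup>2 - x * x) + A * A"
    and pos: "positive_op n (F (\<lambda>x. c\<^sup>2 - x * x))" by auto
  have bound: "vnorm (A *\<^sub>v v) \<le> c" if v: "v \<in> carrier_vec n" "vnorm v = 1" for v
  proof -
    have "((A * A) *\<^sub>v v) \<bullet>c v = (A *\<^sub>v v) \<bullet>c (A *\<^sub>v v)"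
      using cscalar_prod_mult_mat_vec[OF Ac _ v(1), of "A *\<^sub>v v"] Ac v positive_op_adjoint[OF A]
      by (simp add: assoc_mult_mat_vec[of _ n n _ n])
    moreover have "((complex_of_real (c\<^sup>2) \<cdot>\<^sub>m 1\<^sub>m n) *\<^sub>v v) \<bullet>c v = complex_of_real (c\<^sup>2) * (v \<bullet>c v)"
      by (simp only: cscalar_prod_smult_mat[OF one_carrier_mat v(1)] one_mult_mat_vec[OF v(1)])
    moreover have "Re ((F (\<lambda>x. c\<^sup>2 - x * x) *\<^sub>v v) \<bullet>c v) \<ge> 0"
      using pos v by (simp add: positive_op_def)
    moreover have "complex_of_real (c\<^sup>2) * (v \<bullet>c v)
        = (F (\<lambda>x. c\<^sup>2 - x * x) *\<^sub>v v) \<bullet>c v + ((A * A) *\<^sub>v v) \<bullet>c v"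
      using calculation(2) unfolding eq
      by (simp only: cscalar_prod_add_mat[OF F_carrier mult_carrier_mat[OF Ac Ac] v(1)])
    ultimately have "Re (complex_of_real (c\<^sup>2) * (v \<bullet>c v)) \<ge> Re ((A *\<^sub>v v) \<bullet>c (A *\<^sub>v v))"
      by (simp only: plus_complex.sel)
    then have "(vnorm (A *\<^sub>v v))\<^sup>2 \<le> c\<^sup>2"
      using v by (simp add: Re_cscalar_prod_self del: of_real_power)
    then show ?thesis using c0 by (rule power2_le_imp_le)
  qed
  \<comment> \<open>The supremum can be bounded only over a nonempty set; for \<open>0 < n\<close>
    the first basis vector is a unit vector.\<close>
  have "vnorm (unit_vec n 0) = 1"
  proof -
    have "(unit_vec n 0) \<bullet>c (unit_vec n 0 :: complex vec) = 1" using n by (simp add: conjugate_vec_def)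
    then have "(vnorm (unit_vec n 0))\<^sup>2 = 1" by (simp flip: Re_cscalar_prod_self)
    moreover have "vnorm (unit_vec n 0) \<ge> 0" by (simp add: vnorm_def sum_nonneg)
    ultimately show ?thesis by (simp add: power2_eq_1_iff)
  qed
  then have "op_norm n A \<le> c"
    unfolding op_norm_def using bound by (intro cSUP_least) (auto intro: unit_vec_carrier)
  then show ?thesis using c1 by simp
qed

lemma op_norm_one_projection:
  assumes n: "0 < n" and A: "positive_op n A" "positive_op n (1\<^sub>m n - A)" and norm: "op_norm n A = 1"
  obtains P where "orth_projection n P" "P \<noteq> 0\<^sub>m n n" "A * P = P" "P * A = P"
proof -
  have Ac: "A \<in> carrier_mat n n" using A(1) by (rule positive_op_carrier)
  obtain P Q l where eb: "hermitian_eigenbasis n A P Q l"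
    using hermitian_eigenbasis_exists[OF Ac positive_op_adjoint[OF A(1)]] by blast
  interpret hermitian_eigenbasis n A P Q l by fact
  obtain i where i: "i < n" "l i \<ge> 1"
    using op_norm_less_one[OF n A(1) eb] norm by (metis less_irrefl not_less)
  let ?v = "col P i"
  have v: "?v \<in> carrier_vec n" using P i by auto
  have "(1\<^sub>m n - A) *\<^sub>v ?v = F (\<lambda>x. 1 - x) *\<^sub>v ?v" by (simp flip: F_id F_one F_minus)
  then have "Re (((1\<^sub>m n - A) *\<^sub>v ?v) \<bullet>c ?v) = (1 - l i) * Re (?v \<bullet>c ?v)"
    using eigenvector_col[OF i(1), of "\<lambda>x. 1 - x"] v by simp
  moreover have "Re (((1\<^sub>m n - A) *\<^sub>v ?v) \<bullet>c ?v) \<ge> 0"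
    using A(2) v by (simp add: positive_op_def)
  \<comment> \<open>Positivity of \<open>1 - A\<close> caps the eigenvalues at 1, so the eigenvalue
    found is exactly 1.\<close>
  ultimately have li: "l i = 1"
    using i(2) cscalar_prod_self_pos[OF v col_nonzero[OF i(1)]] by (simp add: zero_le_mult_iff)
  \<comment> \<open>The spectral projection for the eigenvalue 1: the indicator function is
    idempotent and absorbs multiplication by the identity function.\<close>
  define R where "R = F (\<lambda>x. if x = 1 then 1 else 0)"
  show thesis
  proof (rule that[of R])
    have idem: "F (\<lambda>x. (if x = 1 then 1 else 0) * (if x = 1 then 1 else 0)) = R"
      unfolding R_def by (rule F_cong) auto
    show "orth_projection n R"
      using idem by (simp add: orth_projection_def R_def F_adjoint F_mult)
    have "F (\<lambda>x. x * (if x = 1 then 1 else 0)) = R" "F (\<lambda>x. (if x = 1 then 1 else 0) * x) = R"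
      unfolding R_def by (rule F_cong; simp)+
    then show "A * R = R" "R * A = R"
      unfolding R_def by (simp_all add: F_mult flip: F_id)
    have "R *\<^sub>v ?v = ?v" using eigenvector_col[OF i(1), of "\<lambda>x. if x = 1 then 1 else 0"] by (simp add: R_def li)
    moreover have "0\<^sub>m n n *\<^sub>v ?v = 0\<^sub>v n" using v by (intro eq_vecI) auto
    ultimately show "R \<noteq> 0\<^sub>m n n" using col_nonzero[OF i(1)] by auto
  qed
qed

text \<open>The trace of \<open>P\<close> is the sum of all \<open>mtrace (E z * P)\<close>, and the
  term for \<open>x\<close> already equals it. The other terms are nonnegative, so each is zero, and
  for positive operators a zero trace of the product makes the product vanish.\<close>

lemma observable_annihilates:
  assumes obs: "is_observable d X E" and x: "x \<in> X" and P: "orth_projection d P" "E x * P = P"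
    and y: "y \<in> X" "y \<noteq> x"
  shows "P * E y = 0\<^sub>m d d" "E y * P = 0\<^sub>m d d"
proof -
  have X: "finite X" and E: "\<And>z. z \<in> X \<Longrightarrow> positive_op d (E z)" and sum: "msum d E X = 1\<^sub>m d"
    using obs by (auto simp: is_observable_def)
  have Ec: "E z \<in> carrier_mat d d" if "z \<in> X" for z using E[OF that] by (rule positive_op_carrier)
  have Pp: "positive_op d P" using P(1) by (rule orth_projection_positive)
  have Pc: "P \<in> carrier_mat d d" using Pp by (rule positive_op_carrier)
  have "P = msum d E X * P" using Pc by (simp add: sum)
  also have "\<dots> = msum d (\<lambda>z. E z * P) X" using X Pc Ec by (rule msum_mult)
  finally have "mtrace P = mtrace (msum d (\<lambda>z. E z * P) X)" by simp
  also have "\<dots> = (\<Sum>z\<in>X. mtrace (E z * P))"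
    using mult_carrier_mat[OF Ec Pc] by (rule mtrace_msum)
  also have "\<dots> = mtrace P + (\<Sum>z\<in>X - {x}. mtrace (E z * P))"
    using X x P(2) by (simp add: sum.remove)
  finally have "(\<Sum>z\<in>X - {x}. mtrace (E z * P)) = 0" by simp
  then have "(\<Sum>z\<in>X - {x}. Re (mtrace (E z * P))) = 0" by (metis Re_sum zero_complex.sel(1))
  then have "Re (mtrace (E y * P)) = 0"
    using X y mtrace_positive_mult_nonneg[OF E Pp] by (subst (asm) sum_nonneg_eq_0_iff) auto
  then show *: "P * E y = 0\<^sub>m d d" using mtrace_positive_mult_eq_0[OF E[OF y(1)] Pp] by simp
  have "E y * P = mat_adjoint (P * E y)"
    using Pc Ec[OF y(1)] positive_op_adjoint[OF Pp] positive_op_adjoint[OF E[OF y(1)]]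
    by (simp add: mat_adjoint_mult)
  also have "\<dots> = 0\<^sub>m d d" unfolding * by (rule eq_matI) auto
  finally show "E y * P = 0\<^sub>m d d" .
qed

text \<open>Both forms of disturbance follow by testing \<open>P\<close> against the input
  \<open>1 - P\<close>, where an undisturbed \<open>P\<close> would give trace zero.\<close>

lemma norm_one_effect_disturbed:
  assumes d: "0 < d" and obs: "is_observable d X E" and nontriv: "nontrivial_obs d X E"
    and x: "x \<in> X" "op_norm d (E x) = 1"
  shows "\<exists>P. orth_projection d P \<and> (\<forall>y\<in>X. P * E y = E y * P) \<and>
    (\<forall>\<I> m \<xi> \<E> Z. is_instrument d X E \<I> \<and> third_law_scheme_implements d X m \<xi> \<E> Z \<I> \<longrightarrow>
      dual_map d d (total_channel d X \<I>) P \<noteq> P \<and>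
      is_observable d (UNIV :: bool set) (\<lambda>b. if b then P else 1\<^sub>m d - P) \<and>
      \<not> does_not_disturb d X \<I> (UNIV :: bool set) (\<lambda>b. if b then P else 1\<^sub>m d - P))"
proof -
  have X: "finite X" and E: "positive_op d (E x)" "positive_op d (1\<^sub>m d - E x)"
    using obs x by (auto simp: is_observable_def)
  have Ec: "E x \<in> carrier_mat d d" using E(1) by (rule positive_op_carrier)
  obtain P where P: "orth_projection d P" "P \<noteq> 0\<^sub>m d d" "E x * P = P" "P * E x = P"
    using op_norm_one_projection[OF d E x(2)] .
  have Pc: "P \<in> carrier_mat d d" using P(1) by (simp add: orth_projection_def)
  have one: "orth_projection d (1\<^sub>m d)" by (simp add: orth_projection_def)
  have Ex1: "E x \<noteq> 1\<^sub>m d"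
  proof
    assume Ex: "E x = 1\<^sub>m d"
    have "\<exists>c. E y = c \<cdot>\<^sub>m 1\<^sub>m d" if y: "y \<in> X" for y
    proof (cases "y = x")
      case True
      then have "E y = 1 \<cdot>\<^sub>m 1\<^sub>m d" using Ex by (intro eq_matI) auto
      then show ?thesis by blast
    next
      \<comment> \<open>Annihilation applied to the projection 1: a sure outcome \<open>x\<close>
        makes every other effect zero, so all effects would be scalar.\<close>
      case False
      have "E y \<in> carrier_mat d d" using obs y by (auto simp: is_observable_def positive_op_def)
      then have "E y = 0\<^sub>m d d"
        using observable_annihilates(1)[OF obs x(1) one _ y False] Ex by simp
      also have "\<dots> = 0 \<cdot>\<^sub>m 1\<^sub>m d" by (rule eq_matI) auto
      finally show ?thesis by blast
    qed
    then show False using nontriv by (simp add: nontrivial_obs_def)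
  qed
  let ?P' = "1\<^sub>m d - P"
  have P': "orth_projection d ?P'" using orth_projection_complement[OF P(1)] .
  note P'p = orth_projection_positive[OF P']
  have P'c: "?P' \<in> carrier_mat d d" using P'p by (rule positive_op_carrier)
  have PP': "1\<^sub>m d - ?P' = P" using Pc by (intro eq_matI) auto
  \<comment> \<open>If \<open>P\<close> were 1, then \<open>E x * P = P\<close> would give
    \<open>E x = 1\<close>. Being nonzero makes \<open>1 - P\<close> both a legitimate effect and
    normalizable to a state.\<close>
  have P'0: "?P' \<noteq> 0\<^sub>m d d"
  proof
    assume z: "?P' = 0\<^sub>m d d"
    have "P = 1\<^sub>m d - 0\<^sub>m d d" using PP' unfolding z by simp
    also have "\<dots> = 1\<^sub>m d" by (rule eq_matI) auto
    finally show False using P(3) Ex1 Ec by simp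
  qed
  have comm: "\<forall>y\<in>X. P * E y = E y * P"
    using observable_annihilates[OF obs x(1) P(1,3)] P(3,4) by metis
  have "msum d (\<lambda>b. if b then P else ?P') UNIV = 1\<^sub>m d"
    using Pc by (intro eq_matI) (auto simp: UNIV_bool)
  then have bool_obs: "is_observable d (UNIV :: bool set) (\<lambda>b. if b then P else ?P')"
    using P P'0 P'p orth_projection_positive[OF P(1)] by (auto simp: is_observable_def PP')
  have "dual_map d d (total_channel d X \<I>) P \<noteq> P \<and>
      \<not> does_not_disturb d X \<I> (UNIV :: bool set) (\<lambda>b. if b then P else ?P')"
    if inst: "is_instrument d X E \<I>" and impl: "third_law_scheme_implements d X m \<xi> \<E> Z \<I>"
    for \<I> m \<xi> \<E> Z
  proof -
    note lin = completely_positive_linear[OF total_channel_completely_positive[OF X inst]]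
    have ne: "mtrace (P * total_channel d X \<I> ?P') \<noteq> mtrace (P * ?P')"
      using third_law_disturbs_projection[OF d X x(1) P(1,2) E Ex1 P(3) inst impl]
        orth_projection_mult_complement[OF P(1)] by (simp add: mtrace_def)
    have "dual_map d d (total_channel d X \<I>) P \<noteq> P"
      using mtrace_dual_map[OF lin Pc P'c] ne by auto
    moreover have "\<not> does_not_disturb d X \<I> (UNIV :: bool set) (\<lambda>b. if b then P else ?P')"
    proof
      assume undisturbed: "does_not_disturb d X \<I> (UNIV :: bool set) (\<lambda>b. if b then P else ?P')"
      have "mtrace (P * total_channel d X \<I> \<rho>) = mtrace (P * \<rho>)" if "is_state d \<rho>" for \<rho>
        using undisturbed[unfolded does_not_disturb_def, THEN bspec, of True] that by simp
      then show False using mtrace_eq_if_states[OF lin Pc Pc _ P'p P'0] ne by blast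
    qed
    ultimately show ?thesis by simp
  qed
  then show ?thesis using P(1) comm bool_obs by blast
qed

subsection \<open>The Lueders instrument\<close>

lemma mult_mat_zero_vec: "A \<in> carrier_mat n m \<Longrightarrow> A *\<^sub>v 0\<^sub>v m = (0\<^sub>v n :: 'a :: semiring_0 vec)"
  by (rule eq_vecI) (auto simp: scalar_prod_def)

lemma nonsingular_left_inverse:
  assumes A: "(A :: complex mat) \<in> carrier_mat n n" and inj: "\<And>v. v \<in> carrier_vec n \<Longrightarrow> A *\<^sub>v v = 0\<^sub>v n \<Longrightarrow> v = 0\<^sub>v n"
  obtains B where "B \<in> carrier_mat n n" "B * A = 1\<^sub>m n"
proof -
  have "det A \<noteq> 0" using inj det_0_iff_vec_prod_zero_field[OF A] by blast
  from det_non_zero_imp_unit[OF A this, of "()"] that show thesis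
    by (auto simp: Units_def ring_mat_def)
qed

text \<open>If \<open>A\<close> is fixed, then \<open>\<Sum>\<^sub>x tr [S\<^sub>x, A]\<^sup>* [S\<^sub>x, A] = 2 tr A\<^sup>* A - 2 tr A\<^sup>* (\<Sum>\<^sub>x S\<^sub>x A S\<^sub>x) = 0\<close>.\<close>
lemma hermitian_kraus_fixed_point_commutes:
  assumes X: "finite X" and S: "\<And>x. x \<in> X \<Longrightarrow> S x \<in> carrier_mat n n" "\<And>x. x \<in> X \<Longrightarrow> mat_adjoint (S x) = S x"
    and unital: "msum n (\<lambda>x. S x * S x) X = 1\<^sub>m n"
    and A: "A \<in> carrier_mat n n" and fixed: "msum n (\<lambda>x. S x * A * S x) X = A" and x: "x \<in> X"
  shows "S x * A = A * S x"
proof -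
  define a where "a = mat_adjoint A"
  have a: "a \<in> carrier_mat n n" using A by (simp add: a_def)
  define C where "C x = S x * A - A * S x" for x
  have Cc: "C x \<in> carrier_mat n n" if "x \<in> X" for x
    unfolding C_def using mult_carrier_mat[OF A S(1)[OF that]] by (rule minus_carrier_mat)
  let ?u = "\<lambda>x. mtrace (A * a * (S x * S x))"
  let ?w = "\<lambda>x. mtrace (a * A * (S x * S x))"
  let ?z = "\<lambda>x. mtrace (a * (S x * A * S x))"
  have trC: "mtrace (mat_adjoint (C x) * C x) = ?u x + ?w x - 2 * ?z x" if x: "x \<in> X" for x
  proof -
    note Sx = S(1)[OF x]
    have SA: "S x * A \<in> carrier_mat n n" and AS: "A * S x \<in> carrier_mat n n"
      and aS: "a * S x \<in> carrier_mat n n" and Sa: "S x * a \<in> carrier_mat n n"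
      using Sx A a by (auto intro!: mult_carrier_mat[of _ n n])
    have adj: "mat_adjoint (C x) = a * S x - S x * a"
      using Sx A S(2)[OF x] unfolding C_def a_def mat_adjoint_minus[OF SA AS] by (simp add: mat_adjoint_mult)
    have "mat_adjoint (C x) * C x = (a * S x * (S x * A) - S x * a * (S x * A)) - (a * S x * (A * S x) - S x * a * (A * S x))"
      unfolding adj unfolding C_def mult_minus_distrib_mat[OF minus_carrier_mat[OF Sa] SA AS]
        minus_mult_distrib_mat[OF aS Sa SA] minus_mult_distrib_mat[OF aS Sa AS] ..
    then have "mtrace (mat_adjoint (C x) * C x) = mtrace (a * S x * (S x * A)) - mtrace (S x * a * (S x * A))
        - (mtrace (a * S x * (A * S x)) - mtrace (S x * a * (A * S x)))"
      using mult_carrier_mat[OF aS SA] mult_carrier_mat[OF Sa SA] mult_carrier_mat[OF aS AS] mult_carrier_mat[OF Sa AS]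
      by (simp add: mtrace_minus[of _ n] minus_carrier_mat)
    moreover have "mtrace (a * S x * (S x * A)) = ?u x"
      using mtrace_mult_commute[OF mult_carrier_mat[OF aS Sx] A] Sx A a
      by (simp add: assoc_mult_mat_dim)
    moreover have "mtrace (S x * a * (S x * A)) = ?z x"
      using mtrace_mult_commute[OF Sx mult_carrier_mat[OF a SA]] Sx A a
      by (simp add: assoc_mult_mat_dim)
    moreover have "mtrace (a * S x * (A * S x)) = ?z x"
      using Sx A a by (simp add: assoc_mult_mat_dim)
    moreover have "mtrace (S x * a * (A * S x)) = ?w x"
      using mtrace_mult_commute[OF Sx mult_carrier_mat[OF a AS]] Sx A a
      by (simp add: assoc_mult_mat_dim)
    ultimately show ?thesis by simp
  qed
  have SS: "S x * S x \<in> carrier_mat n n" if "x \<in> X" for x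
    using mult_carrier_mat[OF S(1)[OF that] S(1)[OF that]] .
  have SAS: "S x * A * S x \<in> carrier_mat n n" if "x \<in> X" for x
    using mult_carrier_mat[OF mult_carrier_mat[OF S(1)[OF that] A] S(1)[OF that]] .
  have sumSS: "(\<Sum>x\<in>X. mtrace (B * (S x * S x))) = mtrace B" if B: "B \<in> carrier_mat n n" for B
    using mtrace_msum[of X "\<lambda>x. B * (S x * S x)" n] mult_msum[OF X B, of "\<lambda>x. S x * S x"] SS B
      mult_carrier_mat[OF B SS] by (simp add: unital)
  have sumz: "(\<Sum>x\<in>X. ?z x) = mtrace (a * A)"
    using mtrace_msum[of X "\<lambda>x. a * (S x * A * S x)" n] mult_msum[OF X a, of "\<lambda>x. S x * A * S x"] SAS
      mult_carrier_mat[OF a SAS] by (simp add: fixed)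
  have "(\<Sum>x\<in>X. mtrace (mat_adjoint (C x) * C x)) = (\<Sum>x\<in>X. ?u x) + (\<Sum>x\<in>X. ?w x) - 2 * (\<Sum>x\<in>X. ?z x)"
    by (simp add: trC sum.distrib sum_subtractf sum_distrib_left)
  also have "\<dots> = 0"
    using mtrace_mult_commute[OF A a]
    by (simp add: sumSS[OF mult_carrier_mat[OF A a]] sumSS[OF mult_carrier_mat[OF a A]] sumz)
  \<comment> \<open>Each summand is a squared Hilbert-Schmidt norm, so a zero sum makes every single
    commutator vanish.\<close>
  finally have "(\<Sum>x\<in>X. Re (mtrace (mat_adjoint (C x) * C x))) = 0"
    by (metis Re_sum zero_complex.sel(1))
  then have "Re (mtrace (mat_adjoint (C x) * C x)) = 0"
    using X x mtrace_square_nonneg[OF Cc] by (subst (asm) sum_nonneg_eq_0_iff) auto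
  then have "C x = 0\<^sub>m n n" using mtrace_square_eq_0[OF Cc[OF x]] by blast
  then have z: "C x $$ (i,j) = 0" if "i < n" "j < n" for i j using that by simp
  show ?thesis
  proof (rule eq_matI)
    fix i j assume "i < dim_row (A * S x)" "j < dim_col (A * S x)"
    then have ij: "i < n" "j < n" using A S(1)[OF x] by auto
    then show "(S x * A) $$ (i,j) = (A * S x) $$ (i,j)"
      using z[OF ij] A S(1)[OF x] by (simp add: C_def del: index_mult_mat(1))
  qed (use A S(1)[OF x] in auto)
qed

section \<open>Pointer algebra and Kraus maps preserving full rank\<close>

lemma kron_msum_msum:
  assumes "\<And>x. x \<in> X \<Longrightarrow> A x \<in> carrier_mat n n" "\<And>y. y \<in> Y \<Longrightarrow> B y \<in> carrier_mat m m"
  shows "msum (n*m) (\<lambda>(x,y). kron (A x) (B y)) (X \<times> Y) = kron (msum n A X) (msum m B Y)"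
proof (rule eq_matI)
  fix i j assume "i < dim_row (kron (msum n A X) (msum m B Y))" "j < dim_col (kron (msum n A X) (msum m B Y))"
  then have i: "i < n*m" and j: "j < n*m" by auto
  note ij = prod_index_div_mod[OF i] prod_index_div_mod[OF j]
  have "msum (n*m) (\<lambda>(x,y). kron (A x) (B y)) (X \<times> Y) $$ (i,j) = (\<Sum>x\<in>X. \<Sum>y\<in>Y. kron (A x) (B y) $$ (i,j))"
    using i j by (simp add: sum.cartesian_product case_prod_beta)
  also have "\<dots> = (\<Sum>x\<in>X. \<Sum>y\<in>Y. A x $$ (i div m, j div m) * B y $$ (i mod m, j mod m))"
  proof (intro sum.cong refl)
    fix x y assume "x \<in> X" "y \<in> Y"
    then show "kron (A x) (B y) $$ (i,j) = A x $$ (i div m, j div m) * B y $$ (i mod m, j mod m)"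
      using assms(1)[of x] assms(2)[of y] i j by simp
  qed
  also have "\<dots> = kron (msum n A X) (msum m B Y) $$ (i,j)"
    using i j ij by (simp add: sum_product)
  finally show "msum (n*m) (\<lambda>(x,y). kron (A x) (B y)) (X \<times> Y) $$ (i,j) = kron (msum n A X) (msum m B Y) $$ (i,j)" .
qed auto

lemma munit_mult:
  assumes "j < n" "k < n"
  shows "munit n i j * munit n k l = (if j = k then munit n i l else 0\<^sub>m n n)"
proof (rule eq_matI)
  fix a b assume "a < dim_row (if j = k then munit n i l else 0\<^sub>m n n)" "b < dim_col (if j = k then munit n i l else 0\<^sub>m n n)"
  then have ab: "a < n" "b < n" by (auto split: if_splits)
  have "(munit n i j * munit n k l) $$ (a,b) = (\<Sum>c<n. munit n i j $$ (a,c) * munit n k l $$ (c,b))"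
    using ab by (simp add: mult_mat_index_sum del: index_mult_mat(1) munit_index)
  also have "\<dots> = (\<Sum>c<n. if c = j then (if a = i \<and> j = k \<and> b = l then 1 else 0) else 0)"
    using ab by (intro sum.cong refl) auto
  also have "\<dots> = (if j = k then munit n i l else 0\<^sub>m n n) $$ (a,b)"
    using assms ab by simp
  finally show "(munit n i j * munit n k l) $$ (a,b) = (if j = k then munit n i l else 0\<^sub>m n n) $$ (a,b)" .
qed auto

lemma munit_adjoint [simp]: "mat_adjoint (munit n i j) = munit n j i"
  by (rule eq_matI) auto

lemma mtrace_munit: "i < n \<Longrightarrow> mtrace (munit n i i) = 1"
  by (simp add: mtrace_def cong: sum.cong_simp)

lemma msum_munit: "msum n (\<lambda>k. munit n k k) {..<n} = 1\<^sub>m n"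
proof (rule eq_matI)
  fix i j assume "i < dim_row (1\<^sub>m n :: complex mat)" "j < dim_col (1\<^sub>m n :: complex mat)"
  then have ij: "i < n" "j < n" by auto
  have "(\<Sum>k<n. munit n k k $$ (i,j)) = (\<Sum>k<n. if k = i then (if i = j then 1 else 0) else 0)"
    using ij by (intro sum.cong refl) auto
  then show "msum n (\<lambda>k. munit n k k) {..<n} $$ (i,j) = 1\<^sub>m n $$ (i,j)"
    using ij by simp
qed auto

lemma msum_reindex_bij_betw:
  assumes "bij_betw e X Y"
  shows "msum n (\<lambda>x. f (e x)) X = msum n f Y"
  unfolding msum_def using sum.reindex_bij_betw[OF assms, of "\<lambda>y. f y $$ (_,_)"] by simp

lemma positive_op_munit: "i < n \<Longrightarrow> positive_op n (munit n i i)"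
  using positive_op_square[of "munit n i i" n] by (simp add: munit_mult)

text \<open>If the sum annihilates \<open>v\<close>, its quadratic form vanishes there, and so does
  that of each positive summand. Since \<open>T\<close> is definite, every
  \<open>mat_adjoint (K a)\<close> annihilates \<open>v\<close>, and \<open>inj\<close>
  applies.\<close>

lemma posdef_op_msum_conj:
  assumes J: "finite J" and K: "\<And>a. a \<in> J \<Longrightarrow> K a \<in> carrier_mat n n" and T: "posdef_op n T"
    and inj: "\<And>v. v \<in> carrier_vec n \<Longrightarrow> (\<And>a. a \<in> J \<Longrightarrow> mat_adjoint (K a) *\<^sub>v v = 0\<^sub>v n) \<Longrightarrow> v = 0\<^sub>v n"
  shows "posdef_op n (msum n (\<lambda>a. K a * T * mat_adjoint (K a)) J)"
proof (rule posdef_op_if_injective)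
  have Tp: "positive_op n T" using T by (rule posdef_op_positive)
  have Tc: "T \<in> carrier_mat n n" using Tp by (rule positive_op_carrier)
  have pos: "positive_op n (K a * T * mat_adjoint (K a))" if "a \<in> J" for a
    using positive_op_conj[OF Tp K[OF that]] .
  then show "positive_op n (msum n (\<lambda>a. K a * T * mat_adjoint (K a)) J)"
    by (rule positive_op_msum[OF J])
  fix v assume v: "v \<in> carrier_vec n" and z: "msum n (\<lambda>a. K a * T * mat_adjoint (K a)) J *\<^sub>v v = 0\<^sub>v n"
  have "(\<Sum>a\<in>J. ((K a * T * mat_adjoint (K a)) *\<^sub>v v) \<bullet>c v) = 0"
    using cscalar_prod_msum[OF J v, of "\<lambda>a. K a * T * mat_adjoint (K a)"] positive_op_carrier[OF pos] z v
    by simp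
  then have sum0: "(\<Sum>a\<in>J. Re (((K a * T * mat_adjoint (K a)) *\<^sub>v v) \<bullet>c v)) = 0"
    by (metis Re_sum zero_complex.sel(1))
  show "v = 0\<^sub>v n"
  proof (rule inj[OF v])
    fix a assume a: "a \<in> J"
    let ?w = "mat_adjoint (K a) *\<^sub>v v"
    have w: "?w \<in> carrier_vec n" using K[OF a] v by (auto intro!: mult_mat_vec_carrier[of _ n n])
    have "Re (((K a * T * mat_adjoint (K a)) *\<^sub>v v) \<bullet>c v) = 0"
      using sum0 J a pos v by (subst (asm) sum_nonneg_eq_0_iff) (auto simp: positive_op_def)
    moreover have "(K a * T * mat_adjoint (K a)) *\<^sub>v v = K a *\<^sub>v (T *\<^sub>v ?w)"
      using K[OF a] Tc v w
      by (simp add: assoc_mult_mat_vec[of _ n n _ n])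
    moreover have "(K a *\<^sub>v (T *\<^sub>v ?w)) \<bullet>c v = (T *\<^sub>v ?w) \<bullet>c ?w"
      using cscalar_prod_mult_mat_vec[OF K[OF a] _ v, of "T *\<^sub>v ?w"] Tc w by simp
    ultimately show "?w = 0\<^sub>v n" using T w unfolding posdef_op_def by force
  qed
qed

lemma completely_unsharp_third_law_scheme:
  assumes d: "0 < d" and obs: "is_observable d X E" and unsharp: "completely_unsharp X E"
  shows "\<exists>\<I> m \<xi> \<E> Z. is_instrument d X E \<I> \<and> third_law_scheme_implements d X m \<xi> \<E> Z \<I> \<and>
    (\<forall>(Y :: 'y set) F. is_observable d Y F \<longrightarrow>
        (\<forall>x\<in>X. \<forall>y\<in>Y. F y * E x = E x * F y) \<longrightarrow> does_not_disturb d X \<I> Y F) \<and>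
    fixed_points d (total_channel d X \<I>) = commutant d X E"
proof -
  have X: "finite X" and E: "\<And>x. x \<in> X \<Longrightarrow> positive_op d (E x)" and sumE: "msum d E X = 1\<^sub>m d"
    using obs by (auto simp: is_observable_def)
  have Ec: "E x \<in> carrier_mat d d" if "x \<in> X" for x using E[OF that] by (rule positive_op_carrier)
  have "\<forall>x\<in>X. \<exists>S. S \<in> carrier_mat d d \<and> mat_adjoint S = S \<and> S * S = E x \<and>
      (\<forall>B\<in>carrier_mat d d. B * E x = E x * B \<longrightarrow> B * S = S * B)"
    using positive_op_sqrt[OF E] by metis
  then obtain S where S: "\<And>x. x \<in> X \<Longrightarrow> S x \<in> carrier_mat d d" "\<And>x. x \<in> X \<Longrightarrow> mat_adjoint (S x) = S x"
      "\<And>x. x \<in> X \<Longrightarrow> S x * S x = E x"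
    and comm: "\<And>x B. x \<in> X \<Longrightarrow> B \<in> carrier_mat d d \<Longrightarrow> B * E x = E x * B \<Longrightarrow> B * S x = S x * B"
    by metis
  \<comment> \<open>A kernel vector of \<open>S x\<close> is an eigenvector of \<open>E x\<close>
    for the eigenvalue 0, which unsharpness excludes; hence the root is invertible.\<close>
  have "\<exists>T. T \<in> carrier_mat d d \<and> T * S x = 1\<^sub>m d" if x: "x \<in> X" for x
  proof -
    have "v = 0\<^sub>v d" if v: "v \<in> carrier_vec d" "S x *\<^sub>v v = 0\<^sub>v d" for v
    proof (rule ccontr)
      assume "v \<noteq> 0\<^sub>v d"
      moreover have "E x *\<^sub>v v = S x *\<^sub>v (S x *\<^sub>v v)"
        using S(1,3)[OF x] v(1) by (metis assoc_mult_mat_vec)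
      then have "E x *\<^sub>v v = 0 \<cdot>\<^sub>v v" using S(1)[OF x] v by (intro eq_vecI) auto
      ultimately have "0 \<in> spectrum (E x)"
        using v(1) Ec[OF x] by (auto simp: spectrum_def eigenvalue_def eigenvector_def)
      then show False using unsharp x by (simp add: completely_unsharp_def)
    qed
    then show ?thesis using nonsingular_left_inverse[OF S(1)[OF x]] by metis
  qed
  then obtain T where T: "\<And>x. x \<in> X \<Longrightarrow> T x \<in> carrier_mat d d" "\<And>x. x \<in> X \<Longrightarrow> T x * S x = 1\<^sub>m d"
    by metis
  define \<I> where "\<I> x \<rho> = S x * \<rho> * mat_adjoint (S x)" for x \<rho>
  have \<I>: "\<I> x \<rho> = S x * \<rho> * S x" if "x \<in> X" for x \<rho> using S(2)[OF that] by (simp add: \<I>_def)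
  have \<I>c: "\<I> x \<rho> \<in> carrier_mat d d" if "x \<in> X" "\<rho> \<in> carrier_mat d d" for x \<rho>
    unfolding \<I>[OF that(1)] using S(1)[OF that(1)] that(2) by (auto intro!: mult_carrier_mat[of _ d d])
  have inst: "is_instrument d X E \<I>"
    unfolding is_instrument_def
  proof (intro conjI ballI allI impI)
    fix x assume x: "x \<in> X"
    have "\<I> x = (\<lambda>\<rho>. S x * \<rho> * mat_adjoint (S x))" by (simp add: \<I>_def fun_eq_iff)
    then show "completely_positive d d (\<I> x)" using completely_positive_conj[OF S(1)[OF x]] by simp
    fix \<rho> assume "is_state d \<rho>"
    then have \<rho>: "\<rho> \<in> carrier_mat d d" by (auto simp: is_state_def positive_op_def)
    have "mtrace (S x * (\<rho> * S x)) = mtrace (\<rho> * S x * S x)"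
      by (rule mtrace_mult_commute[OF S(1)[OF x] mult_carrier_mat[OF \<rho> S(1)[OF x]]])
    also have "\<dots> = mtrace (\<rho> * E x)" using \<rho> S(1,3)[OF x] by (simp add: assoc_mult_mat_dim)
    also have "\<dots> = mtrace (E x * \<rho>)" by (rule mtrace_mult_commute[OF \<rho> Ec[OF x]])
    finally show "mtrace (\<I> x \<rho>) = mtrace (E x * \<rho>)"
      using \<I>[OF x, of \<rho>] \<rho> S(1)[OF x] by (simp add: assoc_mult_mat_dim)
  qed
  \<comment> \<open>The dual of the total channel. It has the same form as the channel because the
    Kraus operators are Hermitian.\<close>
  define D where "D A = msum d (\<lambda>x. S x * A * S x) X" for A
  have D: "mtrace (D A * B) = mtrace (A * total_channel d X \<I> B)"
    if A: "A \<in> carrier_mat d d" and B: "B \<in> carrier_mat d d" for A B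
  proof -
    have SAS: "S x * A * S x \<in> carrier_mat d d" if "x \<in> X" for x
      using \<I>c[OF that A] \<I>[OF that] by simp
    have "mtrace (D A * B) = (\<Sum>x\<in>X. mtrace (S x * A * S x * B))"
      unfolding D_def using mult_carrier_mat[OF SAS B]
      by (simp add: msum_mult[OF X B SAS] mtrace_msum[of X _ d])
    also have "\<dots> = (\<Sum>x\<in>X. mtrace (A * \<I> x B))"
    proof (rule sum.cong[OF refl])
      fix x assume x: "x \<in> X"
      have "mtrace (S x * (A * S x * B)) = mtrace (A * S x * B * S x)"
        using S(1)[OF x] A B by (intro mtrace_mult_commute[of _ d d]) (auto intro!: mult_carrier_mat[of _ d d])
      then show "mtrace (S x * A * S x * B) = mtrace (A * \<I> x B)"
        using S(1)[OF x] A B by (simp add: \<I>[OF x] assoc_mult_mat_dim)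
    qed
    also have "\<dots> = mtrace (A * total_channel d X \<I> B)"
      unfolding total_channel_def using mult_carrier_mat[OF A \<I>c[OF _ B]]
      by (simp add: mult_msum[OF X A \<I>c[OF _ B]] mtrace_msum[of X _ d])
    finally show ?thesis .
  qed
  have dual: "dual_map d d (total_channel d X \<I>) A = D A" if "A \<in> carrier_mat d d" for A
    using D[OF that] by (intro dual_map_eqI) (auto simp: D_def)
  have D_commutant: "D A = A" if A: "A \<in> carrier_mat d d" and AE: "\<And>x. x \<in> X \<Longrightarrow> A * E x = E x * A" for A
  proof -
    \<comment> \<open>Commutation with \<open>E x\<close> passes to its root, so the two roots can
      be collected on one side; summing over \<open>x\<close> then returns \<open>A\<close>.\<close>
    have "S x * A * S x = A * E x" if x: "x \<in> X" for x
      using comm[OF x A AE[OF x], symmetric] S(1)[OF x] A by (simp add: assoc_mult_mat_dim S(3)[OF x])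
    then have "D A = msum d (\<lambda>x. A * E x) X"
      unfolding D_def by (rule msum_cong)
    also have "\<dots> = A * msum d E X" using Ec by (rule mult_msum[OF X A, symmetric])
    finally have "D A = A * msum d E X" .
    then show ?thesis using A by (simp add: sumE)
  qed
  have undisturbed: "does_not_disturb d X \<I> Y F"
    if F: "is_observable d Y F" "\<forall>x\<in>X. \<forall>y\<in>Y. F y * E x = E x * F y" for Y :: "'y set" and F
    unfolding does_not_disturb_def
  proof (intro ballI allI impI)
    fix y \<rho> assume y: "y \<in> Y" and \<rho>: "is_state d \<rho>"
    have "F y \<in> carrier_mat d d" "\<rho> \<in> carrier_mat d d"
      using F y \<rho> by (auto simp: is_observable_def is_state_def positive_op_def)
    then show "mtrace (F y * total_channel d X \<I> \<rho>) = mtrace (F y * \<rho>)"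
      using D[of "F y" \<rho>] D_commutant[of "F y"] F(2) y by simp
  qed
  have fixed: "fixed_points d (total_channel d X \<I>) = commutant d X E"
  proof (intro subset_antisym subsetI)
    fix A assume "A \<in> fixed_points d (total_channel d X \<I>)"
    then have A: "A \<in> carrier_mat d d" and "D A = A" using dual by (auto simp: fixed_points_def)
    moreover have "msum d (\<lambda>x. S x * S x) X = 1\<^sub>m d"
      unfolding sumE[symmetric] by (rule msum_cong) (rule S(3))
    ultimately have SA: "S x * A = A * S x" if "x \<in> X" for x
      using hermitian_kraus_fixed_point_commutes[OF X S(1,2)] that by (simp add: D_def)
    have "A * E x = E x * A" if x: "x \<in> X" for x
    proof -
      have "A * E x = (A * S x) * S x" using A S(1)[OF x] by (simp add: assoc_mult_mat_dim S(3)[OF x])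
      also have "\<dots> = S x * (A * S x)" using A S(1)[OF x] by (simp add: assoc_mult_mat_dim flip: SA[OF x])
      also have "\<dots> = (S x * S x) * A" using A S(1)[OF x] by (simp add: assoc_mult_mat_dim flip: SA[OF x])
      finally show ?thesis by (simp add: S(3)[OF x])
    qed
    then show "A \<in> commutant d X E" using A by (simp add: commutant_def)
  next
    fix A assume "A \<in> commutant d X E"
    then show "A \<in> fixed_points d (total_channel d X \<I>)"
      using D_commutant[of A] dual[of A] by (simp add: commutant_def fixed_points_def)
  qed
  define N where "N = card X"
  \<comment> \<open>The pointer has one level per outcome, and a scheme needs an ancilla of positive
    dimension.\<close>
  have "X \<noteq> {}"
  proof
    assume "X = {}"
    then have "0\<^sub>m d d = (1\<^sub>m d :: complex mat)" using sumE by (simp add: msum_empty)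
    then show False using d by (metis index_one_mat(1) index_zero_mat(1) zero_neq_one)
  qed
  then have N: "0 < N" using X by (simp add: N_def card_gt_0_iff)
  \<comment> \<open>Outcomes have an arbitrary type, so an enumeration turns them into labels of
    pointer levels.\<close>
  obtain e where e: "bij_betw e X {..<N}"
    using ex_bij_betw_finite_nat[OF X] by (auto simp: N_def lessThan_atLeast0)
  have eN: "e x < N" if "x \<in> X" for x using e that by (auto dest: bij_betwE)
  have einj: "e x = e y \<longleftrightarrow> x = y" if "x \<in> X" "y \<in> X" for x y
    using e that by (auto simp: bij_betw_def inj_on_def)
  define \<xi> where "\<xi> = complex_of_real (1/N) \<cdot>\<^sub>m 1\<^sub>m N"
  define Z where "Z x = munit N (e x) (e x)" for x
  have Zc: "Z x \<in> carrier_mat N N" for x by (simp add: Z_def)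
  \<comment> \<open>Here \<open>a = (x,k)\<close>: the old pointer level \<open>k\<close> is
    discarded and the outcome \<open>x\<close> is written in its place.\<close>
  define K where "K a = kron (S (fst a)) (munit N (e (fst a)) (snd a))" for a
  define J where "J = X \<times> {..<N}"
  define \<E> where "\<E> \<tau> = msum (d*N) (\<lambda>a. K a * \<tau> * mat_adjoint (K a)) J" for \<tau>
  have J: "finite J" using X by (simp add: J_def)
  have Kc: "K a \<in> carrier_mat (d*N) (d*N)" if "a \<in> J" for a
    using kron_carrier[OF S(1) munit_carrier] that by (auto simp: K_def J_def)
  have Ka: "mat_adjoint (K a) = kron (S (fst a)) (munit N (snd a) (e (fst a)))" if "a \<in> J" for a
    using that S(2) by (auto simp: K_def J_def kron_adjoint)
  have \<xi>full: "full_rank_state N \<xi>"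
  proof -
    have "mtrace (1\<^sub>m N) = of_nat N" by (simp add: mtrace_def)
    then have "mtrace \<xi> = 1" using N by (simp add: \<xi>_def mtrace_smult[of _ N])
    moreover have "posdef_op N \<xi>" unfolding \<xi>_def by (rule posdef_op_smult) (use N in auto)
    ultimately show ?thesis using posdef_op_positive by (auto simp: full_rank_state_def is_state_def)
  qed
  have cp: "completely_positive (d*N) (d*N) \<E>"
    unfolding \<E>_def using completely_positive_msum[OF J completely_positive_conj[OF Kc]] .
  \<comment> \<open>The pointer factors multiply to |k><k|, so the sum factorizes into the
    completeness relations of \<open>E\<close> and of the pointer basis.\<close>
  have KK: "msum (d*N) (\<lambda>a. mat_adjoint (K a) * K a) J = 1\<^sub>m (d*N)"
  proof -
    have "msum (d*N) (\<lambda>a. mat_adjoint (K a) * K a) J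
        = msum (d*N) (\<lambda>(x,k). kron (E x) (munit N k k)) J"
    proof (rule msum_cong)
      fix a assume a: "a \<in> J"
      then obtain x k where xk: "a = (x,k)" "x \<in> X" "k < N" by (auto simp: J_def)
      show "mat_adjoint (K a) * K a = (case a of (x,k) \<Rightarrow> kron (E x) (munit N k k))"
        using S(1,3)[OF xk(2)] eN[OF xk(2)] unfolding Ka[OF a]
        by (simp add: K_def xk(1) kron_mult munit_mult)
    qed
    also have "\<dots> = kron (msum d E X) (msum N (\<lambda>k. munit N k k) {..<N})"
      unfolding J_def by (rule kron_msum_msum) (use Ec in auto)
    finally show ?thesis by (simp add: sumE msum_munit kron_one)
  qed
  have tp: "mtrace (\<E> A) = mtrace A" if A: "A \<in> carrier_mat (d*N) (d*N)" for A
  proof -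
    have KAK: "K a * A * mat_adjoint (K a) \<in> carrier_mat (d*N) (d*N)" if "a \<in> J" for a
      using Kc[OF that] A by (auto intro!: mult_carrier_mat[of _ "d*N" "d*N"])
    have KKc: "mat_adjoint (K a) * K a \<in> carrier_mat (d*N) (d*N)" if "a \<in> J" for a
      using Kc[OF that] by (auto intro!: mult_carrier_mat[of _ "d*N" "d*N"])
    have "mtrace (\<E> A) = (\<Sum>a\<in>J. mtrace (K a * A * mat_adjoint (K a)))"
      unfolding \<E>_def by (rule mtrace_msum[OF KAK])
    also have "\<dots> = (\<Sum>a\<in>J. mtrace (mat_adjoint (K a) * K a * A))"
    proof (rule sum.cong[OF refl])
      fix a assume a: "a \<in> J"
      have "mtrace (K a * A * mat_adjoint (K a)) = mtrace (mat_adjoint (K a) * (K a * A))"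
        using Kc[OF a] A by (intro mtrace_mult_commute[of _ "d*N" "d*N"]) (auto intro!: mult_carrier_mat[of _ "d*N" "d*N"])
      then show "mtrace (K a * A * mat_adjoint (K a)) = mtrace (mat_adjoint (K a) * K a * A)"
        using Kc[OF a] A by (simp add: assoc_mult_mat_dim)
    qed
    also have "\<dots> = mtrace (msum (d*N) (\<lambda>a. mat_adjoint (K a) * K a) J * A)"
      using mtrace_msum[of J "\<lambda>a. mat_adjoint (K a) * K a * A" "d*N"] mult_carrier_mat[OF KKc A]
        msum_mult[OF J A, of "\<lambda>a. mat_adjoint (K a) * K a"] KKc by simp
    finally show ?thesis using A by (simp add: KK)
  qed
  have inj: "v = 0\<^sub>v (d*N)"
    if v: "v \<in> carrier_vec (d*N)" and z: "\<And>a. a \<in> J \<Longrightarrow> mat_adjoint (K a) *\<^sub>v v = 0\<^sub>v (d*N)" for v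
  proof -
    have kz: "kron (1\<^sub>m d) (Z x) *\<^sub>v v = 0\<^sub>v (d*N)" if x: "x \<in> X" for x
    proof -
      have a: "(x,0) \<in> J" using x N by (simp add: J_def)
      have TK: "kron (T x) (munit N (e x) 0) \<in> carrier_mat (d*N) (d*N)"
        using kron_carrier[OF T(1)[OF x] munit_carrier] .
      \<comment> \<open>Multiplying by T_x \<otimes> |x><0| undoes the root and leaves the
        projection onto pointer level \<open>x\<close>. The single level \<open>k = 0\<close>
        suffices.\<close>
      have "kron (1\<^sub>m d) (Z x) = kron (T x) (munit N (e x) 0) * mat_adjoint (K (x,0))"
        using T[OF x] S(1)[OF x] N unfolding Ka[OF a] by (simp add: kron_mult munit_mult Z_def)
      then have "kron (1\<^sub>m d) (Z x) *\<^sub>v v = kron (T x) (munit N (e x) 0) *\<^sub>v (mat_adjoint (K (x,0)) *\<^sub>v v)"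
        using TK Kc[OF a] v by (simp add: assoc_mult_mat_vec[of _ "d*N" "d*N" _ "d*N"])
      then have "kron (1\<^sub>m d) (Z x) *\<^sub>v v = kron (T x) (munit N (e x) 0) *\<^sub>v 0\<^sub>v (d*N)"
        by (simp only: z[OF a])
      also have "\<dots> = 0\<^sub>v (d*N)" by (rule mult_mat_zero_vec[OF TK])
      finally show ?thesis .
    qed
    have "msum (d*N) (\<lambda>x. kron (1\<^sub>m d) (Z x)) X = kron (1\<^sub>m d) (msum N Z X)"
      by (rule kron_msum_right[symmetric]) (auto simp: Z_def)
    also have "msum N Z X = 1\<^sub>m N"
      unfolding Z_def msum_reindex_bij_betw[OF e, of N "\<lambda>k. munit N k k"] by (rule msum_munit)
    finally have one: "msum (d*N) (\<lambda>x. kron (1\<^sub>m d) (Z x)) X = 1\<^sub>m (d*N)" by (simp add: kron_one)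
    \<comment> \<open>The pointer projections resolve the identity and each of them annihilates
      \<open>v\<close>, so the squared length of \<open>v\<close> is zero.\<close>
    have "v \<bullet>c v = (\<Sum>x\<in>X. (kron (1\<^sub>m d) (Z x) *\<^sub>v v) \<bullet>c v)"
      using cscalar_prod_msum[OF X v, of "\<lambda>x. kron (1\<^sub>m d) (Z x)"] v
      by (simp add: one kron_carrier[OF one_carrier_mat Zc])
    also have "\<dots> = 0" using v by (simp add: kz)
    finally show ?thesis using v by simp
  qed
  have third: "third_law_channel (d*N) (d*N) \<E>"
    unfolding third_law_channel_def is_channel_def
  proof (intro conjI allI impI ballI)
    fix \<rho> assume \<rho>: "full_rank_state (d*N) \<rho>"
    then have "posdef_op (d*N) (\<E> \<rho>)"
      unfolding \<E>_def using posdef_op_msum_conj[OF J Kc _ inj] by (simp add: full_rank_state_def)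
    then show "full_rank_state (d*N) (\<E> \<rho>)"
      using \<rho> tp[of \<rho>] posdef_op_positive by (auto simp: full_rank_state_def is_state_def positive_op_carrier)
  qed (use cp tp in auto)
  have impl: "\<I> x \<rho> = ptrace2 d N (kron (1\<^sub>m d) (Z x) * \<E> (kron \<rho> \<xi>))"
    if x: "x \<in> X" and \<rho>: "\<rho> \<in> carrier_mat d d" for x \<rho>
  proof -
    have \<xi>c: "\<xi> \<in> carrier_mat N N" by (simp add: \<xi>_def)
    have k\<xi>: "kron \<rho> \<xi> \<in> carrier_mat (d*N) (d*N)" using kron_carrier[OF \<rho> \<xi>c] .
    have KTK: "K a * kron \<rho> \<xi> * mat_adjoint (K a) \<in> carrier_mat (d*N) (d*N)" if "a \<in> J" for a
      using Kc[OF that] k\<xi> by (auto intro!: mult_carrier_mat[of _ "d*N" "d*N"])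
    have kZ: "kron (1\<^sub>m d) (Z x) \<in> carrier_mat (d*N) (d*N)"
      unfolding Z_def by (rule kron_carrier[OF one_carrier_mat munit_carrier])
    \<comment> \<open>Each ancilla level has weight 1/N in the maximally mixed state, and reading
      the pointer keeps only the Kraus operators that wrote \<open>x\<close>.\<close>
    have summand: "ptrace2 d N (kron (1\<^sub>m d) (Z x) * (K a * kron \<rho> \<xi> * mat_adjoint (K a)))
        = (if fst a = x then complex_of_real (1/N) else 0) \<cdot>\<^sub>m \<I> (fst a) \<rho>" if a: "a \<in> J" for a
    proof -
      obtain y k where yk: "a = (y,k)" "y \<in> X" "k < N" using a by (auto simp: J_def)
      note Sy = S(1)[OF yk(2)]
      have "munit N (e y) k * \<xi> = complex_of_real (1/N) \<cdot>\<^sub>m munit N (e y) k"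
        unfolding \<xi>_def using mult_smult_distrib[OF munit_carrier one_carrier_mat] by simp
      then have m: "munit N (e y) k * \<xi> * munit N k (e y) = complex_of_real (1/N) \<cdot>\<^sub>m munit N (e y) (e y)"
        using yk(3) mult_smult_assoc_mat[OF munit_carrier munit_carrier] by (simp add: munit_mult)
      have zm: "Z x * (complex_of_real (1/N) \<cdot>\<^sub>m munit N (e y) (e y))
          = complex_of_real (1/N) \<cdot>\<^sub>m (if y = x then munit N (e y) (e y) else 0\<^sub>m N N)"
        unfolding Z_def mult_smult_distrib[OF munit_carrier munit_carrier]
        using eN[OF x] eN[OF yk(2)] einj[OF x yk(2)] by (auto simp: munit_mult)
      have "kron (1\<^sub>m d) (Z x) * (K a * kron \<rho> \<xi> * mat_adjoint (K a))
          = kron (1\<^sub>m d) (Z x) * kron (S y * \<rho> * S y) (munit N (e y) k * \<xi> * munit N k (e y))"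
        unfolding Ka[OF a] using Sy \<rho> \<xi>c by (simp add: K_def yk(1) kron_mult)
      also have "\<dots> = kron (S y * \<rho> * S y) (Z x * (complex_of_real (1/N) \<cdot>\<^sub>m munit N (e y) (e y)))"
        unfolding m using Sy \<rho> by (subst kron_mult) (auto simp: Z_def)
      finally have "kron (1\<^sub>m d) (Z x) * (K a * kron \<rho> \<xi> * mat_adjoint (K a))
          = kron (\<I> y \<rho>) (complex_of_real (1/N) \<cdot>\<^sub>m (if y = x then munit N (e y) (e y) else 0\<^sub>m N N))"
        unfolding zm \<I>[OF yk(2)] .
      then have "ptrace2 d N (kron (1\<^sub>m d) (Z x) * (K a * kron \<rho> \<xi> * mat_adjoint (K a)))
          = mtrace (complex_of_real (1/N) \<cdot>\<^sub>m (if y = x then munit N (e y) (e y) else 0\<^sub>m N N)) \<cdot>\<^sub>m \<I> y \<rho>"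
        using ptrace2_kron[OF \<I>c[OF yk(2) \<rho>]] by simp
      also have "mtrace (complex_of_real (1/N) \<cdot>\<^sub>m (if y = x then munit N (e y) (e y) else 0\<^sub>m N N))
          = (if y = x then complex_of_real (1/N) else 0)"
        using mtrace_smult[OF munit_carrier] mtrace_munit[OF eN[OF yk(2)]]
        by (cases "y = x") (auto simp: mtrace_def[of "0\<^sub>m N N"])
      finally show ?thesis by (simp add: yk(1))
    qed
    have "ptrace2 d N (kron (1\<^sub>m d) (Z x) * \<E> (kron \<rho> \<xi>))
        = msum d (\<lambda>a. (if fst a = x then complex_of_real (1/N) else 0) \<cdot>\<^sub>m \<I> (fst a) \<rho>) J"
      unfolding \<E>_def
      using mult_msum[OF J kZ, of "\<lambda>a. K a * kron \<rho> \<xi> * mat_adjoint (K a)"] KTK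
      by (simp add: ptrace2_msum summand cong: msum_cong)
    also have "\<dots> = \<I> x \<rho>"
    proof (rule eq_matI)
      fix i j assume "i < dim_row (\<I> x \<rho>)" "j < dim_col (\<I> x \<rho>)"
      then have ij: "i < d" "j < d" using \<I>c[OF x \<rho>] by auto
      have "msum d (\<lambda>a. (if fst a = x then complex_of_real (1/N) else 0) \<cdot>\<^sub>m \<I> (fst a) \<rho>) J $$ (i,j)
          = (\<Sum>y\<in>X. \<Sum>k<N. ((if y = x then complex_of_real (1/N) else 0) \<cdot>\<^sub>m \<I> y \<rho>) $$ (i,j))"
        unfolding J_def msum_index[OF ij] sum.cartesian_product by (rule sum.cong) auto
      \<comment> \<open>The \<open>N\<close> levels \<open>k\<close> contribute equally, which
        cancels the factor 1/N.\<close>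
      also have "\<dots> = (\<Sum>y\<in>X. if y = x then \<I> y \<rho> $$ (i,j) else 0)"
      proof (rule sum.cong[OF refl])
        fix y assume "y \<in> X"
        then show "(\<Sum>k<N. ((if y = x then complex_of_real (1/N) else 0) \<cdot>\<^sub>m \<I> y \<rho>) $$ (i,j))
            = (if y = x then \<I> y \<rho> $$ (i,j) else 0)"
          using \<I>c[OF _ \<rho>, of y] ij N by simp
      qed
      also have "\<dots> = \<I> x \<rho> $$ (i,j)" using X x by simp
      finally show "msum d (\<lambda>a. (if fst a = x then complex_of_real (1/N) else 0) \<cdot>\<^sub>m \<I> (fst a) \<rho>) J $$ (i,j)
          = \<I> x \<rho> $$ (i,j)" .
    qed (use \<I>c[OF x \<rho>] in auto)
    finally show ?thesis by simp
  qed
  have "msum N Z X = 1\<^sub>m N"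
    unfolding Z_def msum_reindex_bij_betw[OF e, of N "\<lambda>k. munit N k k"] by (rule msum_munit)
  then have "third_law_scheme_implements d X N \<xi> \<E> Z \<I>"
    unfolding third_law_scheme_implements_def
    using N \<xi>full third positive_op_munit[OF eN] impl
    by (auto simp: full_rank_state_def third_law_channel_def Z_def)
  then show ?thesis using inst undisturbed fixed by blast
qed

theorem theorem1:
  fixes d :: nat and X :: "'x set" and E :: "'x \<Rightarrow> complex mat"
  assumes d2: "2 \<le> d"
    and obs: "is_observable d X E"
    and nontriv: "nontrivial_obs d X E"
  shows
    "(completely_unsharp X E \<longrightarrow>
       (\<exists>(\<I> :: 'x \<Rightarrow> complex mat \<Rightarrow> complex mat) m \<xi> \<E> Z.
          is_instrument d X E \<I> \<and> third_law_scheme_implements d X m \<xi> \<E> Z \<I> \<and>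
          (\<forall>(Y :: nat set) F. is_observable d Y F \<longrightarrow>
              (\<forall>x\<in>X. \<forall>y\<in>Y. F y * E x = E x * F y) \<longrightarrow> does_not_disturb d X \<I> Y F) \<and>
          fixed_points d (total_channel d X \<I>) = commutant d X E))
     \<and>
     ((\<exists>x\<in>X. op_norm d (E x) = 1) \<longrightarrow>
       (\<exists>P. orth_projection d P \<and> (\<forall>y\<in>X. P * E y = E y * P) \<and>
          (\<forall>(\<I> :: 'x \<Rightarrow> complex mat \<Rightarrow> complex mat) m \<xi> \<E> Z.
              is_instrument d X E \<I> \<and> third_law_scheme_implements d X m \<xi> \<E> Z \<I> \<longrightarrow>
              dual_map d d (total_channel d X \<I>) P \<noteq> P \<and>
              is_observable d (UNIV :: bool set) (\<lambda>b. if b then P else 1\<^sub>m d - P) \<and>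
              \<not> does_not_disturb d X \<I> (UNIV :: bool set) (\<lambda>b. if b then P else 1\<^sub>m d - P))))"
proof (intro conjI impI)
  have d: "0 < d" using d2 by simp
  assume "completely_unsharp X E"
  from completely_unsharp_third_law_scheme[OF d obs this]
  show "\<exists>(\<I> :: 'x \<Rightarrow> complex mat \<Rightarrow> complex mat) m \<xi> \<E> Z.
      is_instrument d X E \<I> \<and> third_law_scheme_implements d X m \<xi> \<E> Z \<I> \<and>
      (\<forall>(Y :: nat set) F. is_observable d Y F \<longrightarrow>
          (\<forall>x\<in>X. \<forall>y\<in>Y. F y * E x = E x * F y) \<longrightarrow> does_not_disturb d X \<I> Y F) \<and>
      fixed_points d (total_channel d X \<I>) = commutant d X E" .
next
  have d: "0 < d" using d2 by simp
  assume "\<exists>x\<in>X. op_norm d (E x) = 1"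
  then obtain x where "x \<in> X" "op_norm d (E x) = 1" by blast
  from norm_one_effect_disturbed[OF d obs nontriv this]
  show "\<exists>P. orth_projection d P \<and> (\<forall>y\<in>X. P * E y = E y * P) \<and>
      (\<forall>(\<I> :: 'x \<Rightarrow> complex mat \<Rightarrow> complex mat) m \<xi> \<E> Z.
          is_instrument d X E \<I> \<and> third_law_scheme_implements d X m \<xi> \<E> Z \<I> \<longrightarrow>
          dual_map d d (total_channel d X \<I>) P \<noteq> P \<and>
          is_observable d (UNIV :: bool set) (\<lambda>b. if b then P else 1\<^sub>m d - P) \<and>
          \<not> does_not_disturb d X \<I> (UNIV :: bool set) (\<lambda>b. if b then P else 1\<^sub>m d - P))" .
qed

end
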